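(* Let $\mathcal{F}$ be a real closed field. Then no two endless indiscernible sequences of elements of $\mathcal{F}$ are strongly perpendicular.
   Context: Language of ordered fields; $\mathfrak C$ denotes a monster model of $\mathrm{Th}(\mathcal F)$ and all sequences below are indiscernible sequences in $\mathfrak C$. A sequence is endless if its index set has no last element. "For every large enough $t\in I$, $P(t)$" means there is $t_0\in I$ with $P(t)$ for all $t\ge t_0$. For an endless indiscernible sequence $\bar{\mathbf a}=\langle \bar a_t:t\in I\rangle$ and $B\subseteq\mathfrak C$, $\mathrm{Av}(B,\bar{\mathbf a})$ is the set of all $\varphi(\bar x,\bar b)^{\mathbf t}$ ($\bar b$ from $B$, $\varphi^1=\varphi$, $\varphi^0=\neg\varphi$) such that for every large enough $t\in I$, $\models\varphi[\bar a_t,\bar b]^{\mathbf t}$. Two sequences are mutually indiscernible over $A$ if each is indiscernible over $A$ together with the other. Endless indiscernible $\bar{\mathbf a}^1,\bar{\mathbf a}^2$ are perpendicular iff for every $A\subset\mathfrak C$ there is a family $\langle\bar b^\ell_n:\ell\in\{1,2\},n<\omega\rangle$ with each $\bar b^\ell_n$ realizing $\mathrm{Av}(A\cup\bar{\mathbf a}^1\cup\bar{\mathbf a}^2\cup\{\bar b^k_m:k\in\{1,2\},\ m<n\text{ or }(m=n\wedge k<\ell)\},\bar{\mathbf a}^\ell)$ such that $\langle\bar b^1_n\rangle_n,\langle\bar b^2_n\rangle_n$ are mutually indiscernible over $A\cup\bar{\mathbf a}^1\cup\bar{\mathbf a}^2$. Two indiscernible sequences $\langle a^\ell_t:t\in I^\ell\rangle$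 ($\ell=1,2$) are immediate neighbors if there are an indiscernible sequence $\langle b_s:s\in J\rangle$ and injections $\sigma^\ell:I^\ell\to J$, each either order preserving or order reversing, with $a^\ell_t=b_{\sigma^\ell(t)}$ for all $\ell,t$. Two indiscernible sequences $\bar{\mathbf a}^1,\bar{\mathbf a}^2$ are neighbors if there is a finite chain $\bar{\mathbf b}^0=\bar{\mathbf a}^1,\bar{\mathbf b}^1,\dots,\bar{\mathbf b}^k=\bar{\mathbf a}^2$ of indiscernible sequences with consecutive members immediate neighbors. Endless indiscernible sequences $\bar{\mathbf a}^1,\bar{\mathbf a}^2$ in $\mathcal F$ are strongly perpendicular iff $\bar{\mathbf c}^1,\bar{\mathbf c}^2$ are perpendicular whenever $\bar{\mathbf c}^i$ is an (endless) indiscernible sequence that is a neighbor of $\bar{\mathbf a}^i$ for $i\in\{1,2\}$.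
   Formalization: Both sequences are assumed nonconstant, and empty sequences are not admitted as members of a chain of neighbors; without the first condition two constant sequences with value 0 would be strongly perpendicular. *)

theory Defs
  imports Main "HOL-Computational_Algebra.Polynomial"
begin

unbundle cardinal_syntax

section \<open>First-order logic of ordered fields\<close>

text \<open>
  Variables are named by natural numbers. A structure for the language
  \<open>0, 1, +, -, *, <\<close> is a type of class \<open>linordered_field\<close>. This is no restriction here, because
  every model of the theory of an ordered field is an ordered field.
\<close>

datatype tm = Var nat | Zero | One | Add tm tm | Minus tm | Times tm tm

datatype fm = Equal tm tm | Less tm tm | Neg fm | Conj fm fm | Exists nat fm

primrec tm_vars :: "tm \<Rightarrow> nat set" where
  "tm_vars (Var i) = {i}"
| "tm_vars Zero = {}"
| "tm_vars One = {}"
| "tm_vars (Add s t) = tm_vars s \<union> tm_vars t"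
| "tm_vars (Minus t) = tm_vars t"
| "tm_vars (Times s t) = tm_vars s \<union> tm_vars t"

primrec free_vars :: "fm \<Rightarrow> nat set" where
  "free_vars (Equal s t) = tm_vars s \<union> tm_vars t"
| "free_vars (Less s t) = tm_vars s \<union> tm_vars t"
| "free_vars (Neg \<phi>) = free_vars \<phi>"
| "free_vars (Conj \<phi> \<psi>) = free_vars \<phi> \<union> free_vars \<psi>"
| "free_vars (Exists i \<phi>) = free_vars \<phi> - {i}"

primrec tm_val :: "(nat \<Rightarrow> 'c::linordered_field) \<Rightarrow> tm \<Rightarrow> 'c" where
  "tm_val e (Var i) = e i"
| "tm_val e Zero = 0"
| "tm_val e One = 1"
| "tm_val e (Add s t) = tm_val e s + tm_val e t"
| "tm_val e (Minus t) = - tm_val e t"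
| "tm_val e (Times s t) = tm_val e s * tm_val e t"

primrec sat :: "(nat \<Rightarrow> 'c::linordered_field) \<Rightarrow> fm \<Rightarrow> bool" where
  "sat e (Equal s t) \<longleftrightarrow> tm_val e s = tm_val e t"
| "sat e (Less s t) \<longleftrightarrow> tm_val e s < tm_val e t"
| "sat e (Neg \<phi>) \<longleftrightarrow> \<not> sat e \<phi>"
| "sat e (Conj \<phi> \<psi>) \<longleftrightarrow> sat e \<phi> \<and> sat e \<psi>"
| "sat e (Exists i \<phi>) \<longleftrightarrow> (\<exists>x. sat (e(i := x)) \<phi>)"

definition Th :: "'f::linordered_field itself \<Rightarrow> fm set" where
  "Th _ = {\<phi>. free_vars \<phi> = {} \<and> (\<forall>e :: nat \<Rightarrow> 'f. sat e \<phi>)}"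

definition models :: "'c::linordered_field itself \<Rightarrow> fm set \<Rightarrow> bool" where
  "models _ T \<longleftrightarrow> (\<forall>\<phi>\<in>T. \<forall>e :: nat \<Rightarrow> 'c. sat e \<phi>)"

definition real_closed :: "'f::linordered_field itself \<Rightarrow> bool" where
  "real_closed _ \<longleftrightarrow>
     (\<forall>x::'f. 0 \<le> x \<longrightarrow> (\<exists>y. y ^ 2 = x)) \<and>
     (\<forall>p::'f poly. odd (degree p) \<longrightarrow> (\<exists>x. poly p x = 0))"


section \<open>Types in one variable and monster models\<close>

text \<open>
  A pair \<open>(\<phi>, e)\<close> stands for the formula \<open>\<phi>(x, b)\<close> in which \<open>x\<close> is variable \<open>0\<close> and
  the parameters \<open>b\<close> are the values under \<open>e\<close> of the other free variables of \<open>\<phi>\<close>.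
\<close>

definition formulas_over :: "'c set \<Rightarrow> (fm \<times> (nat \<Rightarrow> 'c)) set" where
  "formulas_over A = {(\<phi>, e). e ` (free_vars \<phi> - {0}) \<subseteq> A}"

definition realizes :: "'c::linordered_field \<Rightarrow> (fm \<times> (nat \<Rightarrow> 'c)) set \<Rightarrow> bool" where
  "realizes x p \<longleftrightarrow> (\<forall>(\<phi>, e)\<in>p. sat (e(0 := x)) \<phi>)"

definition saturated :: "'k rel \<Rightarrow> 'c::linordered_field itself \<Rightarrow> bool" where
  "saturated \<kappa> _ \<longleftrightarrow>
     (\<forall>(A::'c set) p. |A| <o \<kappa> \<and> p \<subseteq> formulas_over A \<and>
        (\<forall>q\<subseteq>p. finite q \<longrightarrow> (\<exists>x. realizes x q)) \<longrightarrow> (\<exists>x. realizes x p))"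

definition elementary_on :: "'c::linordered_field set \<Rightarrow> ('c \<Rightarrow> 'c) \<Rightarrow> bool" where
  "elementary_on A f \<longleftrightarrow>
     (\<forall>\<phi> e. e ` free_vars \<phi> \<subseteq> A \<longrightarrow> (sat (f \<circ> e) \<phi> \<longleftrightarrow> sat e \<phi>))"

definition automorphism :: "('c::linordered_field \<Rightarrow> 'c) \<Rightarrow> bool" where
  "automorphism h \<longleftrightarrow> bij h \<and> h 0 = 0 \<and> h 1 = 1 \<and>
     (\<forall>x y. h (x + y) = h x + h y) \<and> (\<forall>x. h (- x) = - h x) \<and>
     (\<forall>x y. h (x * y) = h x * h y) \<and> (\<forall>x y. h x < h y \<longleftrightarrow> x < y)"

definition strongly_homogeneous :: "'k rel \<Rightarrow> 'c::linordered_field itself \<Rightarrow> bool" where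
  "strongly_homogeneous \<kappa> _ \<longleftrightarrow>
     (\<forall>(A::'c set) f. |A| <o \<kappa> \<and> elementary_on A f \<longrightarrow>
        (\<exists>h. automorphism h \<and> (\<forall>x\<in>A. h x = f x)))"

text \<open>
  The cardinal \<open>\<kappa>\<close> is the bound below which sets of parameters and index sets count as small.
  The only largeness imposed on it is that it exceeds the cardinality of the language.
\<close>

definition monster_model :: "'k rel \<Rightarrow> 'c::linordered_field itself \<Rightarrow> fm set \<Rightarrow> bool" where
  "monster_model \<kappa> C T \<longleftrightarrow>
     Card_order \<kappa> \<and> natLeq <o \<kappa> \<and>
     models C T \<and> saturated \<kappa> C \<and> strongly_homogeneous \<kappa> C"


section \<open>Indiscernible sequences\<close>

text \<open>
  A sequence \<open>\<langle>a\<^sub>t : t \<in> I\<rangle>\<close> of elements is given by a reflexive linear order on \<open>I\<close> and a function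
  on the index type. The index set \<open>I\<close> is the field of the order; values of the function outside
  \<open>I\<close> are irrelevant.
\<close>

record ('i, 'c) sequence =
  ord :: "'i rel"
  val :: "'i \<Rightarrow> 'c"

definition idx :: "('i, 'c) sequence \<Rightarrow> 'i set" where
  "idx S = Field (ord S)"

definition elems :: "('i, 'c) sequence \<Rightarrow> 'c set" where
  "elems S = val S ` idx S"

definition increasing_tuple :: "'i rel \<Rightarrow> nat \<Rightarrow> (nat \<Rightarrow> 'i) \<Rightarrow> bool" where
  "increasing_tuple r n s \<longleftrightarrow>
     (\<forall>i<n. s i \<in> Field r) \<and> (\<forall>j<n. \<forall>i<j. (s i, s j) \<in> r \<and> s i \<noteq> s j)"

text \<open>
  In \<open>\<phi>(x\<^sub>0, \<dots>, x\<^sub>n\<^sub>-\<^sub>1, b)\<close> the first \<open>n\<close> variables receive the members of the sequence and the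
  remaining free variables receive the parameters \<open>b\<close> via \<open>e\<close>.
\<close>

definition indiscernible_over :: "'c::linordered_field set \<Rightarrow> ('i, 'c) sequence \<Rightarrow> bool" where
  "indiscernible_over A S \<longleftrightarrow>
     (\<forall>\<phi> n e s t. e ` (free_vars \<phi> - {..<n}) \<subseteq> A \<and>
        increasing_tuple (ord S) n s \<and> increasing_tuple (ord S) n t \<longrightarrow>
        (sat (\<lambda>i. if i < n then val S (s i) else e i) \<phi> \<longleftrightarrow>
         sat (\<lambda>i. if i < n then val S (t i) else e i) \<phi>))"

definition mutually_indiscernible_over ::
  "'c::linordered_field set \<Rightarrow> ('i, 'c) sequence \<Rightarrow> ('j, 'c) sequence \<Rightarrow> bool" where
  "mutually_indiscernible_over A S T \<longleftrightarrow>
     indiscernible_over (A \<union> elems T) S \<and> indiscernible_over (A \<union> elems S) T"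

text \<open>
  Index sets are small and nonempty, but may be finite. An empty sequence would be an immediate
  neighbor of every sequence, so that any two sequences would be neighbors.
\<close>

definition indiscernible_sequence :: "'k rel \<Rightarrow> ('i, 'c::linordered_field) sequence \<Rightarrow> bool" where
  "indiscernible_sequence \<kappa> S \<longleftrightarrow>
     Linear_order (ord S) \<and> idx S \<noteq> {} \<and> |idx S| <o \<kappa> \<and> indiscernible_over {} S"

definition endless :: "('i, 'c) sequence \<Rightarrow> bool" where
  "endless S \<longleftrightarrow> (\<forall>t\<in>idx S. \<exists>s\<in>idx S. (t, s) \<in> ord S \<and> s \<noteq> t)"

text \<open>
  A constant sequence with value \<open>0\<close> has only constant neighbors (defined below), and constant
  sequences are perpendicular to all endless indiscernible ones. Indiscernible sequences are
  therefore only of interest if they are nonconstant.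
\<close>

definition nonconstant :: "('i, 'c) sequence \<Rightarrow> bool" where
  "nonconstant S \<longleftrightarrow> (\<exists>s\<in>idx S. \<exists>t\<in>idx S. val S s \<noteq> val S t)"


section \<open>Perpendicularity\<close>

definition Av :: "'c::linordered_field set \<Rightarrow> ('i, 'c) sequence \<Rightarrow> (fm \<times> (nat \<Rightarrow> 'c)) set" where
  "Av B S = {(\<phi>, e) \<in> formulas_over B.
     \<exists>t0\<in>idx S. \<forall>t\<in>idx S. (t0, t) \<in> ord S \<longrightarrow> sat (e(0 := val S t)) \<phi>}"

definition perpendicular ::
  "'k rel \<Rightarrow> ('i, 'c::linordered_field) sequence \<Rightarrow> ('j, 'c) sequence \<Rightarrow> bool" where
  "perpendicular \<kappa> S1 S2 \<longleftrightarrow>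
     (\<forall>A. |A| <o \<kappa> \<longrightarrow>
        (\<exists>b1 b2 :: nat \<Rightarrow> 'c.
           (\<forall>n. realizes (b1 n)
              (Av (A \<union> elems S1 \<union> elems S2 \<union> b1 ` {..<n} \<union> b2 ` {..<n}) S1)) \<and>
           (\<forall>n. realizes (b2 n)
              (Av (A \<union> elems S1 \<union> elems S2 \<union> b1 ` {..n} \<union> b2 ` {..<n}) S2)) \<and>
           mutually_indiscernible_over (A \<union> elems S1 \<union> elems S2)
             \<lparr>ord = natLeq, val = b1\<rparr> \<lparr>ord = natLeq, val = b2\<rparr>))"


section \<open>Neighbors\<close>

text \<open>
  From here on all sequences are indexed by subsets of the type \<open>'k\<close> carrying \<open>\<kappa>\<close>. Every
  linear order of cardinality below \<open>\<kappa>\<close> is isomorphic to one of these.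
\<close>

definition order_preserving_on :: "'i set \<Rightarrow> 'i rel \<Rightarrow> 'j rel \<Rightarrow> ('i \<Rightarrow> 'j) \<Rightarrow> bool" where
  "order_preserving_on I r r' \<sigma> \<longleftrightarrow> (\<forall>s\<in>I. \<forall>t\<in>I. (s, t) \<in> r \<longrightarrow> (\<sigma> s, \<sigma> t) \<in> r')"

definition embeds_into :: "('i, 'c) sequence \<Rightarrow> ('j, 'c) sequence \<Rightarrow> bool" where
  "embeds_into S T \<longleftrightarrow>
     (\<exists>\<sigma>. \<sigma> ` idx S \<subseteq> idx T \<and> inj_on \<sigma> (idx S) \<and>
        (order_preserving_on (idx S) (ord S) (ord T) \<sigma> \<or>
         order_preserving_on (idx S) (ord S) ((ord T)\<inverse>) \<sigma>) \<and>
        (\<forall>t\<in>idx S. val S t = val T (\<sigma> t)))"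

definition immediate_neighbors ::
  "'k rel \<Rightarrow> ('k, 'c::linordered_field) sequence \<Rightarrow> ('k, 'c) sequence \<Rightarrow> bool" where
  "immediate_neighbors \<kappa> S1 S2 \<longleftrightarrow>
     (\<exists>T :: ('k, 'c) sequence. indiscernible_sequence \<kappa> T \<and> embeds_into S1 T \<and> embeds_into S2 T)"

definition neighbors ::
  "'k rel \<Rightarrow> ('k, 'c::linordered_field) sequence \<Rightarrow> ('k, 'c) sequence \<Rightarrow> bool" where
  "neighbors \<kappa> S1 S2 \<longleftrightarrow>
     (\<exists>(m::nat) B. B 0 = S1 \<and> B m = S2 \<and>
        (\<forall>i\<le>m. indiscernible_sequence \<kappa> (B i)) \<and>
        (\<forall>i<m. immediate_neighbors \<kappa> (B i) (B (Suc i))))"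

definition strongly_perpendicular ::
  "'k rel \<Rightarrow> ('k, 'c::linordered_field) sequence \<Rightarrow> ('k, 'c) sequence \<Rightarrow> bool" where
  "strongly_perpendicular \<kappa> S1 S2 \<longleftrightarrow>
     (\<forall>T1 T2. indiscernible_sequence \<kappa> T1 \<and> endless T1 \<and> neighbors \<kappa> T1 S1 \<and>
        indiscernible_sequence \<kappa> T2 \<and> endless T2 \<and> neighbors \<kappa> T2 S2 \<longrightarrow>
        perpendicular \<kappa> T1 T2)"

end

(*
A nonconstant endless indiscernible sequence in a real closed field consists of transcendental
elements. Given elements z1, z2 of the two sequences, choose positive d_0, d_1, ... such that d_n is
infinitesimal over the ring generated by z1, z2, d_0, ..., d_(n-1). With v_i = z_i - d_0 the sequence
(v_i + d_n)_n is indiscernible and contains z_i, so it is a neighbor of the i-th sequence through the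
one-element sequence (z_i). The two sequences (v_1 + d_n)_n and (v_2 + d_n)_n are translates of each
other by parameters, so realizations of their averages alternate after translation, and they are not
perpendicular.

Indiscernibility only has to be checked for signs of polynomials. In place of quantifier elimination,
sign-preserving subrings of C x C are extended by Zorn's lemma; a maximal one is closed under roots
(induction on the degree), so the polynomial sign conditions realized over one half of it are finitely
satisfiable over the other half, and saturation gives a back-and-forth argument. The intermediate value
theorem for polynomials in a real closed field is derived from Laplace's proof of the fundamental
theorem of algebra.
*)
theory Submission
  imports Defs "HOL-Algebra.Algebraic_Closure_Type" "HOL-Computational_Algebra.Polynomial_FPS"
    "HOL-Library.Countable_Set_Type"
begin

hide_const (open) Module.module.smult UnivPoly.up_ring.monom UnivPoly.coeff Polynomials.degree Polynomials.lead_coeff Coset.order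

section \<open>Power sums and symmetric functions of roots\<close>

text \<open>A neighbor has to share only one value with the given sequence, so both sequences can be
  replaced by ones built from the same infinitesimals. The shared value must occur literally, which
  forces the shift: z + d_n is never z, while z - d_0 + d_n is z for n = 0. The price is that d_0
  must be infinitesimal over the ring generated by z - d_0, an element that itself involves d_0. If
  f(z) = 0 for a nonzero integer polynomial f, then f(z - d_0) is bounded by a multiple of d_0 and
  this fails; hence the role of transcendence. Rapidly decreasing infinitesimals are indiscernible
  because a polynomial has, at an infinitesimal over its coefficients, the sign of its first nonzero
  coefficient. Passing from signs to arbitrary formulas requires a partner for an arbitrary new
  element x. Over a subring closed under roots, the position of x among finitely many roots decides
  finitely many signs, and a point of the subring in the same position serves as a substitute for
  x.\<close>

definition subring_set :: "'a::comm_ring_1 set \<Rightarrow> bool" where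
  "subring_set S \<longleftrightarrow> 0 \<in> S \<and> 1 \<in> S \<and> (\<forall>a\<in>S. - a \<in> S) \<and> (\<forall>a\<in>S. \<forall>b\<in>S. a + b \<in> S \<and> a * b \<in> S)"

lemma subring_setD:
  assumes "subring_set S"
  shows "0 \<in> S" "1 \<in> S" "a \<in> S \<Longrightarrow> - a \<in> S" "a \<in> S \<Longrightarrow> b \<in> S \<Longrightarrow> a + b \<in> S"
    "a \<in> S \<Longrightarrow> b \<in> S \<Longrightarrow> a * b \<in> S" "a \<in> S \<Longrightarrow> b \<in> S \<Longrightarrow> a - b \<in> S"
  using assms unfolding subring_set_def by (auto simp: diff_conv_add_uminus simp del: add_uminus_conv_diff)

lemma subring_set_sum: "subring_set S \<Longrightarrow> (\<And>i. i \<in> A \<Longrightarrow> f i \<in> S) \<Longrightarrow> sum f A \<in> S"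
  by (induction A rule: infinite_finite_induct) (auto intro: subring_setD)

lemma subring_set_power: "subring_set S \<Longrightarrow> a \<in> S \<Longrightarrow> a ^ n \<in> S"
  by (induction n) (auto intro: subring_setD)

lemma subring_set_of_nat: "subring_set S \<Longrightarrow> of_nat n \<in> S"
  by (induction n) (auto intro: subring_setD)

lemmas subring_set_intros = subring_setD subring_set_sum subring_set_power subring_set_of_nat

text \<open>Logarithmic derivative: \<open>P'/P\<close> is the sum of the geometric series
  \<open>- x i / (1 - x i * X)\<close>.\<close>

lemma fps_deriv_prod_roots:
  fixes x :: "'i \<Rightarrow> 'a::field"
  assumes "finite I"
  defines "P \<equiv> \<lambda>I. \<Prod>i\<in>I. 1 - fps_const (x i) * fps_X"
  shows "fps_deriv (P I) = - P I * Abs_fps (\<lambda>k. \<Sum>i\<in>I. x i ^ Suc k)"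
  using assms(1)
proof (induction I)
  case empty
  have "Abs_fps (\<lambda>k. 0) = (0::'a fps)" by (simp add: fps_eq_iff)
  then show ?case by (simp add: P_def)
next
  case (insert j I)
  define S where "S = Abs_fps (\<lambda>k. \<Sum>i\<in>I. x i ^ Suc k)"
  define G where "G = Abs_fps (\<lambda>k. x j ^ Suc k)"
  have G: "(1 - fps_const (x j) * fps_X) * G = fps_const (x j)"
  proof (rule fps_ext)
    fix n show "((1 - fps_const (x j) * fps_X) * G) $ n = fps_const (x j) $ n"
      by (cases n) (simp_all add: G_def algebra_simps mult.assoc)
  qed
  have S': "Abs_fps (\<lambda>k. \<Sum>i\<in>insert j I. x i ^ Suc k) = G + S"
    using insert by (simp add: S_def G_def fps_eq_iff)
  have P': "P (insert j I) = (1 - fps_const (x j) * fps_X) * P I"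
    using insert by (simp add: P_def)
  have IH: "fps_deriv (P I) = - P I * S" using insert by (simp add: S_def)
  have "fps_deriv (P (insert j I)) = - fps_const (x j) * P I + (1 - fps_const (x j) * fps_X) * (- P I * S)"
    unfolding P' by (simp add: IH)
  also have "\<dots> = - P (insert j I) * (G + S)"
    unfolding P' by (subst G [symmetric]) (simp add: algebra_simps)
  finally show ?case unfolding S' .
qed

text \<open>Newton's identities, obtained by comparing coefficients of degree \<open>n\<close> in
  the equation for the derivative.\<close>

lemma newton_recurrence:
  fixes x :: "'i \<Rightarrow> 'a::field"
  assumes "finite I"
  defines "P \<equiv> \<Prod>i\<in>I. 1 - fps_const (x i) * fps_X"
  shows "of_nat (Suc n) * P $ Suc n = - (\<Sum>k\<le>n. P $ k * (\<Sum>i\<in>I. x i ^ Suc (n - k)))"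
proof -
  have "fps_deriv P $ n = (- P * Abs_fps (\<lambda>k. \<Sum>i\<in>I. x i ^ Suc k)) $ n"
    unfolding P_def using fps_deriv_prod_roots[OF assms(1), of x] by simp
  then show ?thesis
    by (simp add: fps_mult_nth sum_negf atMost_atLeast0)
qed

lemma prod_fps_nth_0: "(\<Prod>i\<in>I. 1 - fps_const (x i) * fps_X) $ 0 = (1 :: 'a::field)"
  by (induction I rule: infinite_finite_induct) simp_all

text \<open>Reversing a polynomial turns the factor \<open>[:- c, 1:]\<close> into
  \<open>1 - c * X\<close>; this links ordinary coefficients with Newton's identities.\<close>

lemma coeff_prod_roots:
  fixes x :: "'i \<Rightarrow> 'a::field"
  assumes "finite I" "k \<le> card I"
  shows "coeff (\<Prod>i\<in>I. [:- x i, 1:]) (card I - k) = (\<Prod>i\<in>I. 1 - fps_const (x i) * fps_X) $ k"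
proof -
  let ?p = "\<Prod>i\<in>I. [:- x i, 1:]"
  have d: "degree ?p = card I" by (simp add: degree_prod_sum_eq)
  have r: "reflect_poly [:- c, 1:] = [:1, - c:]" for c :: 'a
    by (cases "c = 0") (simp_all add: reflect_poly_def)
  have f: "fps_of_poly [:1, - c:] = 1 - fps_const c * fps_X" for c :: 'a
    by (simp add: fps_of_poly_pCons flip: fps_const_neg)
  have "coeff ?p (card I - k) = coeff (reflect_poly ?p) k"
    using assms by (simp add: coeff_reflect_poly d)
  also have "\<dots> = fps_of_poly (\<Prod>i\<in>I. [:1, - x i:]) $ k"
    by (simp add: reflect_poly_prod r)
  also have "\<dots> = (\<Prod>i\<in>I. 1 - fps_const (x i) * fps_X) $ k"
    by (simp only: fps_of_poly_prod f)
  finally show ?thesis .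
qed

lemma coeff_prod_roots_in_iff:
  fixes x :: "'i \<Rightarrow> 'a::field"
  assumes "finite I" "subring_set S"
  shows "(\<forall>k. coeff (\<Prod>i\<in>I. [:- x i, 1:]) k \<in> S) \<longleftrightarrow>
    (\<forall>k. (\<Prod>i\<in>I. 1 - fps_const (x i) * fps_X) $ k \<in> S)" (is "(\<forall>k. coeff ?p k \<in> S) \<longleftrightarrow> (\<forall>k. ?P $ k \<in> S)")
proof -
  have d: "degree ?p = card I" by (simp add: degree_prod_sum_eq)
  have P0: "?P $ k = 0" if "k > card I" for k
  proof -
    have f: "fps_of_poly [:1, - c:] = 1 - fps_const c * fps_X" for c :: 'a
      by (simp add: fps_of_poly_pCons flip: fps_const_neg)
    have "degree (\<Prod>i\<in>I. [:1, - x i:]) \<le> (\<Sum>i\<in>I. degree [:1, - x i:])"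
      using degree_prod_sum_le[OF assms(1), of "\<lambda>i. [:1, - x i:]"] by (simp add: o_def)
    also have "\<dots> \<le> (\<Sum>i\<in>I. 1)" by (intro sum_mono) simp
    finally have "coeff (\<Prod>i\<in>I. [:1, - x i:]) k = 0" using that by (intro coeff_eq_0) simp
    moreover have "?P $ k = fps_of_poly (\<Prod>i\<in>I. [:1, - x i:]) $ k" by (simp only: fps_of_poly_prod f)
    ultimately show ?thesis by simp
  qed
  show ?thesis
  proof safe
    fix k assume *: "\<forall>k. coeff ?p k \<in> S"
    show "?P $ k \<in> S"
      using P0[of k] coeff_prod_roots[OF assms(1), of k x] * assms(2)
      by (cases "k \<le> card I") (metis, simp add: subring_setD)
  next
    fix k assume *: "\<forall>k. ?P $ k \<in> S"
    show "coeff ?p k \<in> S"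
    proof (cases "k \<le> card I")
      case True
      then show ?thesis using coeff_prod_roots[OF assms(1), of "card I - k" x] * by auto
    next
      case False
      then show ?thesis using assms(2) by (simp add: d coeff_eq_0 subring_setD)
    qed
  qed
qed

lemma power_sums_in:
  fixes x :: "'i \<Rightarrow> 'a::field"
  assumes "finite I" "subring_set S" and coeffs: "\<And>k. coeff (\<Prod>i\<in>I. [:- x i, 1:]) k \<in> S"
  shows "(\<Sum>i\<in>I. x i ^ n) \<in> S"
proof -
  define P where "P = (\<Prod>i\<in>I. 1 - fps_const (x i) * fps_X)"
  define s where "s n = (\<Sum>i\<in>I. x i ^ Suc n)" for n
  have P: "P $ k \<in> S" for k
    using coeff_prod_roots_in_iff[OF assms(1,2), of x] coeffs unfolding P_def by blast
  have s: "s n \<in> S" for n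
  proof (induction n rule: less_induct)
    case (less n)
    have "of_nat (Suc n) * P $ Suc n = - (\<Sum>k\<le>n. P $ k * s (n - k))"
      unfolding P_def s_def by (rule newton_recurrence[OF assms(1)])
    \<comment> \<open>The term for k = 0 has coefficient 1, so \<open>s n\<close> can be isolated
      without division.\<close>
    also have "(\<Sum>k\<le>n. P $ k * s (n - k)) = s n + (\<Sum>k\<in>{0<..n}. P $ k * s (n - k))"
      unfolding atMost_atLeast0 by (subst sum.head) (simp_all add: P_def prod_fps_nth_0)
    finally have e: "of_nat (Suc n) * P $ Suc n = - (s n + (\<Sum>k\<in>{0<..n}. P $ k * s (n - k)))" .
    have "s n = - (of_nat (Suc n) * P $ Suc n) - (\<Sum>k\<in>{0<..n}. P $ k * s (n - k))"
      unfolding e by simp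
    also have "\<dots> \<in> S"
      using P less assms(2) by (intro subring_set_intros) auto
    finally show ?case .
  qed
  show ?thesis
    using s assms(2) by (cases n) (auto simp: s_def subring_set_of_nat)
qed

text \<open>Newton's identities are now solved for the coefficients instead of the power sums; this
  divides by \<open>Suc n\<close>, whence the inverses in \<open>S\<close>.\<close>

lemma coeff_prod_roots_in:
  fixes x :: "'i \<Rightarrow> 'a::field_char_0"
  assumes "finite I" "subring_set S" and inv: "\<And>n. inverse (of_nat n) \<in> S"
    and sums: "\<And>n. (\<Sum>i\<in>I. x i ^ n) \<in> S"
  shows "coeff (\<Prod>i\<in>I. [:- x i, 1:]) k \<in> S"
proof -
  define P where "P = (\<Prod>i\<in>I. 1 - fps_const (x i) * fps_X)"
  have P: "P $ k \<in> S" for k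
  proof (induction k rule: less_induct)
    case (less k)
    show ?case
    proof (cases k)
      case 0
      then show ?thesis using assms(2) by (simp add: P_def prod_fps_nth_0 subring_setD)
    next
      case (Suc n)
      have "of_nat (Suc n) * P $ Suc n = - (\<Sum>k\<le>n. P $ k * (\<Sum>i\<in>I. x i ^ Suc (n - k)))"
        unfolding P_def by (rule newton_recurrence[OF assms(1)])
      then have "P $ Suc n = inverse (of_nat (Suc n)) * (- (\<Sum>k\<le>n. P $ k * (\<Sum>i\<in>I. x i ^ Suc (n - k))))"
        by (simp add: divide_simps del: of_nat_Suc) (metis mult.commute)
      also have "\<dots> \<in> S"
        by (intro subring_set_intros inv sums assms(2) less) (auto simp: Suc)
      finally show ?thesis using Suc by simp
    qed
  qed
  then show ?thesis
    using coeff_prod_roots_in_iff[OF assms(1,2), of x] unfolding P_def by blast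
qed

text \<open>The coefficients are symmetric functions of the roots, hence polynomials in power sums.\<close>
lemma coeff_prod_pairs_in:
  fixes x :: "nat \<Rightarrow> 'a::field_char_0"
  assumes S: "subring_set S" and inv: "\<And>n. inverse (of_nat n) \<in> S"
    and coeffs: "\<And>k. coeff (\<Prod>i<n. [:- x i, 1:]) k \<in> S" and h: "h \<in> S"
  shows "coeff (\<Prod>(i,j) | i < j \<and> j < n. [:- (x i + x j + h * x i * x j), 1:]) k \<in> S"
proof -
  define y where "y i j = x i + x j + h * x i * x j" for i j
  let ?J = "{(i, j). i < j \<and> j < n}"
  have fin: "finite ?J" by (rule finite_subset[of _ "{..<n} \<times> {..<n}"]) auto
  have ps: "(\<Sum>i<n. x i ^ r) \<in> S" for r
    by (rule power_sums_in[OF _ S coeffs]) simp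
  \<comment> \<open>The exponents \<open>a\<close>, \<open>b\<close> are carried along for the
    induction: expanding one factor \<open>y i j\<close> gives three sums of the same shape with
    \<open>r\<close> lowered.\<close>
  have all: "(\<Sum>i<n. \<Sum>j<n. x i ^ a * x j ^ b * y i j ^ r) \<in> S" for a b r
  proof (induction r arbitrary: a b)
    case 0
    have "(\<Sum>i<n. \<Sum>j<n. x i ^ a * x j ^ b) = (\<Sum>i<n. x i ^ a) * (\<Sum>j<n. x j ^ b)"
      by (simp add: sum_product)
    then show ?case using ps S by (simp add: subring_setD)
  next
    case (Suc r)
    have "(\<Sum>i<n. \<Sum>j<n. x i ^ a * x j ^ b * y i j ^ Suc r) =
      (\<Sum>i<n. \<Sum>j<n. x i ^ Suc a * x j ^ b * y i j ^ r) + (\<Sum>i<n. \<Sum>j<n. x i ^ a * x j ^ Suc b * y i j ^ r)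
       + h * (\<Sum>i<n. \<Sum>j<n. x i ^ Suc a * x j ^ Suc b * y i j ^ r)"
      by (simp add: sum_distrib_left sum.distrib[symmetric] y_def algebra_simps)
    then show ?case using Suc S h by (simp add: subring_setD del: power_Suc)
  qed
  have diag: "(\<Sum>i<n. x i ^ a * y i i ^ r) \<in> S" for a r
  proof (induction r arbitrary: a)
    case 0
    show ?case using ps by simp
  next
    case (Suc r)
    have "(\<Sum>i<n. x i ^ a * y i i ^ Suc r) =
      2 * (\<Sum>i<n. x i ^ Suc a * y i i ^ r) + h * (\<Sum>i<n. x i ^ Suc (Suc a) * y i i ^ r)"
      by (simp add: sum_distrib_left sum.distrib[symmetric] y_def algebra_simps)
    then show ?case using Suc S h subring_set_of_nat[OF S, of 2] by (simp add: subring_setD del: power_Suc)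
  qed
  have "(\<Sum>(i,j)\<in>?J. y i j ^ r) \<in> S" for r
  proof -
    \<comment> \<open>The square of indices consists of \<open>J\<close>, its mirror image and the
      diagonal. As \<open>y\<close> is symmetric, the sum over \<open>J\<close> is half the
      difference of the full and the diagonal sum.\<close>
    have split: "{..<n} \<times> {..<n} = ?J \<union> ((\<lambda>(i,j). (j,i)) ` ?J \<union> (\<lambda>i. (i,i)) ` {..<n})"
    proof -
      have "(i, j) \<in> ?J \<union> ((\<lambda>(i,j). (j,i)) ` ?J \<union> (\<lambda>i. (i,i)) ` {..<n})" if "i < n" "j < n" for i j
        using that by (cases i j rule: linorder_cases) (auto simp: image_iff)
      then show ?thesis by auto
    qed
    have "(\<Sum>i<n. \<Sum>j<n. y i j ^ r) = (\<Sum>(i,j)\<in>{..<n} \<times> {..<n}. y i j ^ r)"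
      by (simp add: sum.cartesian_product)
    also have "\<dots> = (\<Sum>(i,j)\<in>?J. y i j ^ r) + ((\<Sum>(i,j)\<in>(\<lambda>(i,j). (j,i)) ` ?J. y i j ^ r) + (\<Sum>(i,j)\<in>(\<lambda>i. (i,i)) ` {..<n}. y i j ^ r))"
      unfolding split using fin
      by (subst sum.union_disjoint) (auto intro!: sum.union_disjoint)
    also have "(\<Sum>(i,j)\<in>(\<lambda>(i,j). (j,i)) ` ?J. y i j ^ r) = (\<Sum>(i,j)\<in>?J. y i j ^ r)"
      by (subst sum.reindex) (auto simp: inj_on_def y_def algebra_simps intro!: sum.cong)
    also have "(\<Sum>(i,j)\<in>(\<lambda>i. (i,i)) ` {..<n}. y i j ^ r) = (\<Sum>i<n. y i i ^ r)"
      by (subst sum.reindex) (auto simp: inj_on_def)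
    finally have "(\<Sum>(i,j)\<in>?J. y i j ^ r) = inverse (of_nat 2) * ((\<Sum>i<n. \<Sum>j<n. y i j ^ r) - (\<Sum>i<n. y i i ^ r))"
      by simp
    also have "\<dots> \<in> S"
      using all[of 0 0 r] diag[of 0 r] S inv[of 2] by (intro subring_setD) simp_all
    finally show ?thesis .
  qed
  then have "coeff (\<Prod>ij\<in>?J. [:- (\<lambda>(i,j). y i j) ij, 1:]) k \<in> S"
    by (intro coeff_prod_roots_in[OF fin S inv]) (simp add: case_prod_beta)
  then show ?thesis by (simp add: case_prod_beta y_def)
qed

section \<open>Laplace: roots of polynomials over a real closed field\<close>

lemma poly_map_to_ac_add:
  "poly (map_poly to_ac (p + q)) z = poly (map_poly to_ac p) z + poly (map_poly to_ac q) z"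
  for p q :: "'f::field poly"
proof -
  have "map_poly to_ac (p + q) = map_poly to_ac p + map_poly to_ac q"
    by (rule poly_eqI) (simp add: coeff_map_poly)
  then show ?thesis by simp
qed

lemma poly_map_to_ac_mult:
  "poly (map_poly to_ac (p * q)) z = poly (map_poly to_ac p) z * poly (map_poly to_ac q) z"
  for p q :: "'f::field poly"
proof (induction p)
  case 0
  show ?case by simp
next
  case (pCons a p)
  have "map_poly to_ac (smult a q) = smult (to_ac a) (map_poly to_ac q)"
    by (rule poly_eqI) (simp add: coeff_map_poly)
  with pCons show ?case
    by (simp add: poly_map_to_ac_add map_poly_pCons algebra_simps)
qed

lemma poly_map_to_ac_to_ac: "poly (map_poly to_ac p) (to_ac a) = to_ac (poly p a)"
  for p :: "'f::field poly"
  by (induction p) (simp_all add: map_poly_pCons)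

definition adjoin_root :: "'f::field alg_closure \<Rightarrow> 'f alg_closure set" where
  "adjoin_root \<iota> = {to_ac a + \<iota> * to_ac b | a b. True}"

lemma to_ac_in_adjoin_root: "to_ac a \<in> adjoin_root \<iota>"
  unfolding adjoin_root_def by (rule CollectI, rule exI[of _ a], rule exI[of _ 0]) simp

lemma subring_set_adjoin_root:
  assumes i: "\<iota> ^ 2 = -1"
  shows "subring_set (adjoin_root \<iota>)"
proof -
  have m: "(to_ac a + \<iota> * to_ac b) * (to_ac c + \<iota> * to_ac d) = to_ac (a * c - b * d) + \<iota> * to_ac (a * d + b * c)"
    for a b c d
  proof -
    have "(to_ac a + \<iota> * to_ac b) * (to_ac c + \<iota> * to_ac d)
      = to_ac a * to_ac c + \<iota> ^ 2 * (to_ac b * to_ac d) + \<iota> * (to_ac a * to_ac d + to_ac b * to_ac c)"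
      by (simp add: algebra_simps power2_eq_square)
    then show ?thesis by (simp add: i)
  qed
  have p: "(to_ac a + \<iota> * to_ac b) + (to_ac c + \<iota> * to_ac d) = to_ac (a + c) + \<iota> * to_ac (b + d)" for a b c d
    by (simp add: algebra_simps)
  have n: "- (to_ac a + \<iota> * to_ac b) = to_ac (- a) + \<iota> * to_ac (- b)" for a b
    by (simp add: algebra_simps)
  show ?thesis
    unfolding subring_set_def
  proof (intro conjI ballI)
    show "0 \<in> adjoin_root \<iota>" "1 \<in> adjoin_root \<iota>"
      using to_ac_in_adjoin_root[of 0 \<iota>] to_ac_in_adjoin_root[of 1 \<iota>] by simp_all
    have I: "to_ac a + \<iota> * to_ac b \<in> adjoin_root \<iota>" for a b unfolding adjoin_root_def by blast
    fix z assume "z \<in> adjoin_root \<iota>"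
    then obtain a b where z: "z = to_ac a + \<iota> * to_ac b" unfolding adjoin_root_def by blast
    show "- z \<in> adjoin_root \<iota>" unfolding z n by (rule I)
    fix w assume "w \<in> adjoin_root \<iota>"
    then obtain c d where w: "w = to_ac c + \<iota> * to_ac d" unfolding adjoin_root_def by blast
    show "z + w \<in> adjoin_root \<iota>" "z * w \<in> adjoin_root \<iota>" unfolding z w p m by (rule I)+
  qed
qed

text \<open>Half-angle formulas: \<open>r\<close> is the absolute value of \<open>z\<close>, the
  parts of the root have squares \<open>(r + a) / 2\<close> and \<open>(r - a) / 2\<close>, and the
  sign of one part is adjusted so that \<open>2 * c * d' = b\<close>.\<close>

lemma sqrt_in_adjoin_root:
  fixes z :: "'f::linordered_field alg_closure"
  assumes sqrt: "\<And>x::'f. 0 \<le> x \<Longrightarrow> \<exists>y. y ^ 2 = x" and i: "\<iota> ^ 2 = -1" and z: "z \<in> adjoin_root \<iota>"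
  shows "\<exists>w\<in>adjoin_root \<iota>. w ^ 2 = z"
proof -
  obtain a b where ab: "z = to_ac a + \<iota> * to_ac b" using z unfolding adjoin_root_def by blast
  have sq: "\<exists>y\<ge>0. y ^ 2 = x" if x: "0 \<le> x" for x :: 'f
    using sqrt[OF x] by (metis abs_ge_zero power2_abs)
  obtain r where r: "r \<ge> 0" "r ^ 2 = a ^ 2 + b ^ 2" using sq[of "a ^ 2 + b ^ 2"] by auto
  have "\<bar>a\<bar> \<le> r" using r by (metis abs_le_square_iff abs_of_nonneg le_add_same_cancel1 zero_le_power2)
  then obtain c d where cd: "c ^ 2 = (r + a) / 2" "d ^ 2 = (r - a) / 2"
    using sqrt[of "(r + a) / 2"] sqrt[of "(r - a) / 2"] by (fastforce simp: abs_le_iff)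
  have "(2 * c * d) ^ 2 = 4 * (c ^ 2 * d ^ 2)" by (simp add: power_mult_distrib)
  also have "\<dots> = r ^ 2 - a ^ 2"
  proof -
    have "4 * (s / 2 * (t / 2)) = s * t" for s t :: 'f by simp
    then show ?thesis unfolding cd power2_eq_square[of r] power2_eq_square[of a] square_diff_square_factored .
  qed
  also have "\<dots> = b ^ 2" by (simp add: r)
  finally have "2 * c * d = b \<or> 2 * c * (- d) = b" by (auto simp: power2_eq_iff)
  then obtain d' where d': "2 * c * d' = b" "d' ^ 2 = d ^ 2" by (metis power2_minus)
  have "(to_ac c + \<iota> * to_ac d') ^ 2 = to_ac (c ^ 2) + \<iota> ^ 2 * to_ac (d' ^ 2) + \<iota> * to_ac (2 * c * d')"
    by (simp add: power2_eq_square algebra_simps)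
  also have "\<dots> = to_ac (c ^ 2 - d' ^ 2) + \<iota> * to_ac b"
    by (simp only: i d') simp
  also have "c ^ 2 - d' ^ 2 = a" unfolding d' cd by (simp add: field_simps)
  finally show ?thesis using ab unfolding adjoin_root_def by blast
qed

text \<open>
  Laplace's argument: induction on the exponent of \<open>2\<close> in the degree. The polynomial with roots
  \<open>x\<^sub>i + x\<^sub>j + h x\<^sub>i x\<^sub>j\<close> for \<open>i < j\<close> has a smaller exponent, so for each \<open>h\<close> one of its roots lies in
  \<open>F(\<iota>)\<close>. By the pigeonhole principle the same \<open>i, j\<close> serve two values of \<open>h\<close>, and then
  \<open>x\<^sub>i + x\<^sub>j\<close> and \<open>x\<^sub>i x\<^sub>j\<close> lie in \<open>F(\<iota>)\<close>.
\<close>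
lemma real_closed_complex_root:
  fixes p :: "'f::linordered_field poly"
  assumes rc: "real_closed TYPE('f)" and i: "\<iota> ^ 2 = -1" and deg: "degree p > 0"
  shows "\<exists>z\<in>adjoin_root \<iota>. poly (map_poly to_ac p) z = 0"
proof -
  have sqrt: "\<exists>y. y ^ 2 = x" if "0 \<le> x" for x :: 'f
    using rc that unfolding real_closed_def by blast
  note L = subring_set_adjoin_root[OF i]
  let ?L = "adjoin_root \<iota>"
  have main: "\<exists>z\<in>?L. poly (map_poly to_ac p) z = 0" if "degree p = 2 ^ k * m" "odd m" for k m and p :: "'f poly"
    using that
  proof (induction k arbitrary: p m)
    case 0
    then obtain x where "poly p x = 0" using rc unfolding real_closed_def by auto
    then show ?case using to_ac_in_adjoin_root[of x \<iota>] by (metis poly_map_to_ac_to_ac to_ac_0)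
  next
    case (Suc k)
    define P where "P = map_poly to_ac p"
    define n where "n = degree p"
    have "m > 0" using Suc by (auto intro: Nat.gr0I)
    then have n: "n > 0" "p \<noteq> 0" using Suc by (auto simp: n_def)
    have P: "degree P = n" "P \<noteq> 0" "lead_coeff P = to_ac (lead_coeff p)"
      using n by (auto simp: P_def n_def degree_map_poly coeff_map_poly map_poly_eq_0_iff)
    obtain A where A: "size A = n" "P = smult (lead_coeff P) (\<Prod>x\<in>#A. [:- x, 1:])"
      using alg_closed_imp_factorization[OF P(2)] P(1) by auto
    obtain xs where xs: "mset xs = A" using ex_mset by blast
    define x where "x i = xs ! i" for i
    have len: "length xs = n" using xs A by auto
    have "(\<Prod>x\<in>#A. [:- x, 1:]) = prod_list (map (\<lambda>x. [:- x, 1:]) xs)"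
      by (simp flip: xs prod_mset_prod_list)
    also have "\<dots> = (\<Prod>i<n. [:- x i, 1:])"
      by (simp add: prod.list_conv_set_nth len x_def atLeast0LessThan)
    finally have PA: "P = smult (lead_coeff P) (\<Prod>i<n. [:- x i, 1:])" using A by simp
    have root: "poly P (x i) = 0" if "i < n" for i
      by (subst PA) (use that in \<open>auto simp: poly_prod\<close>)
    let ?F = "range (to_ac :: 'f \<Rightarrow> _)"
    have F: "subring_set ?F"
      unfolding subring_set_def
      by (auto simp flip: to_ac_0 to_ac_1 to_ac_add to_ac_mult to_ac_minus)
    have Finv: "inverse (of_nat n) \<in> ?F" for n
      by (simp flip: to_ac_of_nat to_ac_inverse)
    have co: "coeff (\<Prod>i<n. [:- x i, 1:]) k \<in> ?F" for k
    proof -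
      have "coeff P k = lead_coeff P * coeff (\<Prod>i<n. [:- x i, 1:]) k"
        by (subst PA) (rule coeff_smult)
      then have "coeff (\<Prod>i<n. [:- x i, 1:]) k = coeff P k / lead_coeff P"
        using P(2) by (simp add: field_simps)
      also have "\<dots> = to_ac (coeff p k / lead_coeff p)"
        unfolding to_ac_divide P(3) by (simp add: P_def coeff_map_poly)
      finally show ?thesis by blast
    qed
    define J where "J = {(i, j). i < j \<and> j < n}"
    have finJ: "finite J" unfolding J_def by (rule finite_subset[of _ "{..<n} \<times> {..<n}"]) auto
    have "J = (\<lambda>(j,i). (i,j)) ` Sigma {..<n} (\<lambda>j. {..<j})" by (auto simp: J_def image_iff)
    then have "card J = (\<Sum>j<n. j)" by (simp add: card_image inj_on_def)
    moreover have "2 * (\<Sum>j<k. j) = k * (k - 1)" for k :: nat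
    proof (induction k)
      case (Suc k)
      then show ?case by (cases k) simp_all
    qed simp
    ultimately have J2: "2 * card J = n * (n - 1)" by simp
    \<comment> \<open>The number of pairs, n(n - 1)/2, has exactly one factor 2 fewer than
      \<open>n\<close>, because \<open>n\<close> is even and so \<open>n - 1\<close> is odd.\<close>
    have n_eq: "n = 2 * (2 ^ k * m)" using Suc.prems by (simp add: n_def)
    have "n * (n - 1) = 2 * (2 ^ k * m) * (n - 1)" by (rule arg_cong[OF n_eq, of "\<lambda>k. k * (n - 1)"])
    then have cardJ: "card J = 2 ^ k * (m * (n - 1))" unfolding mult.assoc J2[symmetric] by linarith
    have "even n" using n_eq by simp
    then have odd: "odd (m * (n - 1))" using Suc.prems(2) n by simp
    have "\<exists>ij\<in>J. x (fst ij) + x (snd ij) + of_nat h * x (fst ij) * x (snd ij) \<in> ?L" for h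
    proof -
      define y where "y ij = x (fst ij) + x (snd ij) + of_nat h * x (fst ij) * x (snd ij)" for ij
      define Q where "Q = (\<Prod>ij\<in>J. [:- y ij, 1:])"
      define q where "q = map_poly of_ac Q"
      have "coeff Q k \<in> ?F" for k
        using coeff_prod_pairs_in[OF F Finv co subring_set_of_nat[OF F], of h k]
        unfolding Q_def J_def y_def case_prod_beta .
      then have Q: "Q = map_poly to_ac q"
        by (intro poly_eqI) (simp add: q_def coeff_map_poly to_ac_of_ac)
      have "degree Q = card J" by (simp add: Q_def degree_prod_sum_eq)
      then have "degree q = 2 ^ k * (m * (n - 1))" using Q cardJ by (simp add: degree_map_poly)
      from Suc.IH[OF this odd] obtain w where "w \<in> ?L" "poly Q w = 0" using Q by auto
      then obtain ij where "ij \<in> J" "w = y ij" unfolding Q_def using finJ by (auto simp: poly_prod)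
      then show ?thesis using \<open>w \<in> ?L\<close> unfolding y_def by blast
    qed
    then obtain g where g: "g h \<in> J" "x (fst (g h)) + x (snd (g h)) + of_nat h * x (fst (g h)) * x (snd (g h)) \<in> ?L" for h
      by metis
    have "\<not> inj g" using finJ g(1) by (meson finite_subset image_subsetI infinite_UNIV_nat inj_on_finite)
    then obtain h h' where h: "h \<noteq> h'" "g h = g h'" by (auto simp: inj_on_def)
    define a b where "a = x (fst (g h))" "b = x (snd (g h))"
    have "fst (g h) < n" using g(1)[of h] by (auto simp: J_def)
    then have Pa: "poly P a = 0" using root by (simp add: a_b_def)
    have s1: "a + b + of_nat h * a * b \<in> ?L" "a + b + of_nat h' * a * b \<in> ?L"
      using g(2)[of h] g(2)[of h'] h by (simp_all add: a_b_def)
    have "inverse (of_nat h - of_nat h') = (to_ac (inverse (of_nat h - of_nat h')) :: 'f alg_closure)" by simp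
    then have inv: "inverse (of_nat h - of_nat h') \<in> ?L" by (metis to_ac_in_adjoin_root)
    have "a * b = inverse (of_nat h - of_nat h') * ((a + b + of_nat h * a * b) - (a + b + of_nat h' * a * b))"
      using h by (simp add: field_simps)
    also have "\<dots> \<in> ?L" by (intro subring_setD[OF L] inv s1)
    finally have ab: "a * b \<in> ?L" .
    have "a + b = (a + b + of_nat h * a * b) - of_nat h * (a * b)" by simp
    also have "\<dots> \<in> ?L" by (intro subring_set_intros L ab s1)
    finally have sum: "a + b \<in> ?L" .
    \<comment> \<open>This is the discriminant of the quadratic with roots \<open>a\<close> and
      \<open>b\<close>; its square roots are the two differences.\<close>
    have "(a + b) ^ 2 - of_nat 4 * (a * b) \<in> ?L" by (intro subring_set_intros L ab sum)
    then obtain w where w: "w \<in> ?L" "w ^ 2 = (a + b) ^ 2 - of_nat 4 * (a * b)"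
      using sqrt_in_adjoin_root[OF sqrt i] by blast
    have "w ^ 2 = (a - b) ^ 2" unfolding w by (simp add: power2_eq_square algebra_simps)
    then have "w = a - b \<or> - w = a - b" by (auto simp: power2_eq_iff)
    then have d: "a - b \<in> ?L" using w(1) subring_setD(3)[OF L] by metis
    have h2: "to_ac (inverse 2) \<in> ?L" by (rule to_ac_in_adjoin_root)
    have "a = to_ac (inverse 2) * ((a + b) + (a - b))" by simp
    also have "\<dots> \<in> ?L" by (intro subring_setD[OF L] sum d h2)
    finally show ?case using Pa unfolding P_def by blast
  qed
  obtain m where "degree p = 2 ^ multiplicity 2 (degree p) * m" "\<not> 2 dvd m"
    using multiplicity_decompose'[of "degree p" 2] deg by auto
  then show ?thesis using main by blast
qed

text \<open>A factor with the same sign at both endpoints can be cancelled. A root in the base field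
  outside the interval gives such a linear factor, and a root off the base field gives a quadratic
  one that is positive everywhere. Induction on the degree then ends at a root inside the
  interval.\<close>

theorem real_closed_poly_IVT:
  fixes p :: "'f::linordered_field poly"
  assumes rc: "real_closed TYPE('f)" and "a < b" and "poly p a * poly p b < 0"
  shows "\<exists>x. a < x \<and> x < b \<and> poly p x = 0"
  using assms(3)
proof (induction "degree p" arbitrary: p rule: less_induct)
  case less
  obtain \<iota> :: "'f alg_closure" where i: "\<iota> ^ 2 = -1"
    using nth_root_exists[of 2 "-1 :: 'f alg_closure"] by auto
  have deg: "degree p > 0"
  proof (rule ccontr)
    assume "\<not> degree p > 0"
    then obtain c where "p = [:c:]" by (auto elim: degree_eq_zeroE)
    then show False using less.prems by (simp add: mult_less_0_iff)
  qed
  obtain u v where uv: "poly (map_poly to_ac p) (to_ac u + \<iota> * to_ac v) = 0"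
    using real_closed_complex_root[OF rc i deg] unfolding adjoin_root_def by blast
  show ?case
  proof (cases "v = 0")
    case True
    then have "poly p u = 0" using uv by (simp add: poly_map_to_ac_to_ac)
    then obtain q where q: "p = [:- u, 1:] * q" by (auto simp: poly_eq_0_iff_dvd)
    show ?thesis
    proof (cases "a < u \<and> u < b")
      case True
      then show ?thesis using \<open>poly p u = 0\<close> by blast
    next
      case False
      have "u \<noteq> a" "u \<noteq> b" using less.prems \<open>poly p u = 0\<close> by auto
      then have "(a - u) * (b - u) > 0" using False \<open>a < b\<close> by (auto simp: zero_less_mult_iff)
      moreover have "poly p a * poly p b = ((a - u) * (b - u)) * (poly q a * poly q b)"
        unfolding q by (simp add: algebra_simps)
      ultimately have "poly q a * poly q b < 0" using less.prems
        by (metis less_asym mult_less_0_iff)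
      moreover have "q \<noteq> 0" using deg q by auto
      then have "degree q < degree p" unfolding q by (subst degree_mult_eq) auto
      ultimately show ?thesis using less.hyps[of q] q by auto
    qed
  next
    case False
    define Q where "Q = [:u ^ 2 + v ^ 2, - 2 * u, 1:]"
    define z where "z = to_ac u + \<iota> * to_ac v"
    have Qx: "poly Q x = (x - u) ^ 2 + v ^ 2" for x
      by (simp add: Q_def power2_eq_square algebra_simps)
    have "poly (map_poly to_ac Q) z = (z - to_ac u) ^ 2 + to_ac v ^ 2"
      by (simp add: Q_def map_poly_pCons power2_eq_square algebra_simps)
    also have "\<dots> = 0" by (simp add: z_def power_mult_distrib i)
    finally have Qz: "poly (map_poly to_ac Q) z = 0" .
    have dQ: "degree Q = 2" by (simp add: Q_def)
    have "p mod Q = 0"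
    proof -
      have "degree (p mod Q) < 2"
      proof -
        have "Q \<noteq> 0" using dQ by auto
        then show ?thesis using degree_mod_less[of Q p] dQ by (cases "p mod Q = 0") simp_all
      qed
      define r0 r1 where "r0 = coeff (p mod Q) 0" "r1 = coeff (p mod Q) 1"
      have r: "p mod Q = [:r0, r1:]"
      proof (rule poly_eqI)
        fix k
        show "coeff (p mod Q) k = coeff [:r0, r1:] k"
        proof (cases "k < 2")
          case True
          then show ?thesis by (auto simp: less_2_cases_iff r0_r1_def)
        next
          case False
          then show ?thesis using \<open>degree (p mod Q) < 2\<close>
            by (simp add: coeff_eq_0 coeff_pCons split: nat.split)
        qed
      qed
      have "p = Q * (p div Q) + p mod Q" by simp
      then have "poly (map_poly to_ac (p mod Q)) z = 0"
        using uv Qz by (metis z_def poly_map_to_ac_add poly_map_to_ac_mult mult_zero_left add_0)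
      \<comment> \<open>Squaring moves the equation into the ordered base field, where a vanishing
        sum of two squares forces both to vanish; this replaces comparing real and imaginary
        parts.\<close>
      then have "to_ac (r0 + r1 * u) = - (\<iota> * to_ac (r1 * v))"
        by (simp add: r map_poly_pCons z_def algebra_simps eq_neg_iff_add_eq_0)
      then have "to_ac (r0 + r1 * u) ^ 2 = (\<iota> * to_ac (r1 * v)) ^ 2" by simp
      then have "to_ac ((r0 + r1 * u) ^ 2) = to_ac (- ((r1 * v) ^ 2))"
        unfolding power_mult_distrib[of \<iota>] i by simp
      then have "(r0 + r1 * u) ^ 2 + (r1 * v) ^ 2 = 0" unfolding to_ac_eq_iff by simp
      then have "r1 * v = 0" "r0 + r1 * u = 0" by (simp_all add: sum_power2_eq_zero_iff)
      then show ?thesis using False r by simp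
    qed
    then obtain q where q: "p = Q * q" by (auto simp: dvd_def simp flip: mod_0_imp_dvd)
    have pos: "poly Q x > 0" for x unfolding Qx using False by (simp add: add_nonneg_pos)
    have "poly p a * poly p b = (poly Q a * poly Q b) * (poly q a * poly q b)" unfolding q by simp
    moreover have "poly Q a * poly Q b > 0" using pos by simp
    ultimately have "poly q a * poly q b < 0" using less.prems
      by (metis less_asym mult_less_0_iff)
    moreover have "q \<noteq> 0" using deg q by auto
    then have "degree q < degree p" unfolding q using dQ by (subst degree_mult_eq) auto
    ultimately show ?thesis using less.hyps[of q] q by auto
  qed
qed

section \<open>Real closedness in models, Rolle and the mean value theorem\<close>

primrec all_closure :: "nat \<Rightarrow> fm \<Rightarrow> fm" where
  "all_closure 0 \<phi> = \<phi>"
| "all_closure (Suc n) \<phi> = Neg (Exists n (Neg (all_closure n \<phi>)))"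

lemma free_vars_all_closure: "free_vars (all_closure n \<phi>) = free_vars \<phi> - {..<n}"
  by (induction n) (auto simp: lessThan_Suc)

lemma sat_all_closure: "(\<And>e :: nat \<Rightarrow> 'a::linordered_field. sat e \<phi>) \<Longrightarrow> sat (e :: nat \<Rightarrow> 'a) (all_closure n \<phi>)"
  by (induction n arbitrary: e) simp_all

lemma sat_all_closureD:
  assumes "\<And>e :: nat \<Rightarrow> 'a::linordered_field. sat e (all_closure n \<phi>)"
  shows "sat (e :: nat \<Rightarrow> 'a) \<phi>"
  using assms
proof (induction n arbitrary: e)
  case (Suc n)
  have "sat e (all_closure n \<phi>)" for e :: "nat \<Rightarrow> 'a"
  proof -
    have "sat (e(n := e n)) (all_closure n \<phi>)" using Suc.prems[of e] by (simp del: fun_upd_triv)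
    then show ?thesis by simp
  qed
  from Suc.IH[OF this] show ?case .
qed simp

lemma finite_tm_vars: "finite (tm_vars t)"
  by (induction t) auto

lemma finite_free_vars: "finite (free_vars \<phi>)"
  by (induction \<phi>) (auto simp: finite_tm_vars)

text \<open>\<open>Th\<close> contains only sentences, so a valid formula with free variables is
  transferred through its universal closure.\<close>

lemma models_Th_valid:
  fixes e :: "nat \<Rightarrow> 'c::linordered_field"
  assumes "models TYPE('c) (Th TYPE('f::linordered_field))" and valid: "\<And>e :: nat \<Rightarrow> 'f. sat e \<phi>"
  shows "sat e \<phi>"
proof -
  obtain n where n: "free_vars \<phi> \<subseteq> {..<n}"
    using finite_free_vars by (meson finite_nat_iff_bounded)
  have "all_closure n \<phi> \<in> Th TYPE('f)"
    unfolding Th_def using n sat_all_closure[OF valid] by (auto simp: free_vars_all_closure)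
  then have "sat e (all_closure n \<phi>)" for e :: "nat \<Rightarrow> 'c"
    using assms(1) unfolding models_def by blast
  then show ?thesis by (rule sat_all_closureD)
qed

primrec power_tm :: "nat \<Rightarrow> nat \<Rightarrow> tm" where
  "power_tm i 0 = One"
| "power_tm i (Suc k) = Times (Var i) (power_tm i k)"

text \<open>The coefficients are the variables \<open>0\<close> to \<open>n\<close>. The argument
  \<open>i\<close> is therefore taken to be \<open>Suc n\<close> below, which clashes with none of
  them.\<close>

primrec poly_tm :: "nat \<Rightarrow> nat \<Rightarrow> tm" where
  "poly_tm i 0 = Var 0"
| "poly_tm i (Suc k) = Add (poly_tm i k) (Times (Var (Suc k)) (power_tm i (Suc k)))"

lemma tm_val_poly_tm: "tm_val e (poly_tm i n) = (\<Sum>k\<le>n. e k * e i ^ k)"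
proof -
  have "tm_val e (power_tm i k) = e i ^ k" for k by (induction k) simp_all
  then show ?thesis by (induction n) simp_all
qed

lemma tm_val_poly_tm_upd: "tm_val (e(Suc n := z)) (poly_tm (Suc n) n) = (\<Sum>k\<le>n. e k * z ^ k)"
  unfolding tm_val_poly_tm by (intro sum.cong) auto

lemma real_closed_transfer:
  assumes rc: "real_closed TYPE('f::linordered_field)"
    and models: "models TYPE('c::linordered_field) (Th TYPE('f))"
  shows "real_closed TYPE('c)"
  unfolding real_closed_def
proof (intro conjI allI impI)
  fix x :: 'c assume "0 \<le> x"
  let ?\<phi> = "Neg (Conj (Neg (Less (Var 0) Zero)) (Neg (Exists 1 (Equal (Times (Var 1) (Var 1)) (Var 0)))))"
  have "sat e ?\<phi>" for e :: "nat \<Rightarrow> 'f"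
  proof (cases "e 0 < 0")
    case False
    then obtain y where "y ^ 2 = e 0" using rc unfolding real_closed_def by (meson not_less)
    then show ?thesis by (auto simp: power2_eq_square)
  qed simp
  from models_Th_valid[OF models this, of "\<lambda>_. x"] show "\<exists>y. y ^ 2 = x"
    using \<open>0 \<le> x\<close> by (auto simp: power2_eq_square)
next
  fix p :: "'c poly" assume odd: "odd (degree p)"
  define n where "n = degree p"
  \<comment> \<open>Real closedness is a scheme: one formula for each odd degree, with the
    coefficients as free variables and the leading one required to be nonzero.\<close>
  let ?\<phi> = "Neg (Conj (Neg (Equal (Var n) Zero)) (Neg (Exists (Suc n) (Equal (poly_tm (Suc n) n) Zero))))"
  have "sat e ?\<phi>" for e :: "nat \<Rightarrow> 'f"
  proof (cases "e n = 0")
    case False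
    define q where "q = (\<Sum>k\<le>n. monom (e k) k)"
    have co: "coeff q k = (if k \<le> n then e k else 0)" for k
      by (simp add: q_def coeff_sum coeff_monom)
    have "degree q = n"
      using False by (intro antisym degree_le le_degree) (auto simp: co)
    then have "odd (degree q)" using odd by (simp add: n_def)
    then obtain z where "poly q z = 0" using rc unfolding real_closed_def by blast
    then have "(\<Sum>k\<le>n. e k * z ^ k) = 0" by (simp add: poly_altdef \<open>degree q = n\<close> co)
    then show ?thesis unfolding sat.simps tm_val_poly_tm_upd tm_val.simps by blast
  qed simp
  from models_Th_valid[OF models this, of "coeff p"]
  have "coeff p n = 0 \<or> (\<exists>z. (\<Sum>k\<le>n. coeff p k * z ^ k) = 0)"
    unfolding sat.simps tm_val_poly_tm_upd tm_val.simps by blast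
  moreover have "coeff p n \<noteq> 0" using odd by (auto simp: n_def)
  ultimately show "\<exists>x. poly p x = 0" by (auto simp: poly_altdef n_def)
qed

text \<open>This property is all that the rest of the argument takes from real closedness.\<close>

locale poly_IVT_field =
  fixes field_type :: "'a::linordered_field itself"
  assumes poly_IVT: "a < b \<Longrightarrow> poly p a * poly p b < 0 \<Longrightarrow> \<exists>x::'a. a < x \<and> x < b \<and> poly p x = 0"
begin

lemma poly_sgn_eq:
  assumes "a \<le> (b::'a)" "\<And>x. a \<le> x \<Longrightarrow> x \<le> b \<Longrightarrow> poly p x \<noteq> 0"
  shows "sgn (poly p a) = sgn (poly p b)"
proof (rule ccontr)
  assume *: "sgn (poly p a) \<noteq> sgn (poly p b)"
  then have "a < b" using assms(1) by (cases "a = b") auto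
  moreover have "poly p a \<noteq> 0" "poly p b \<noteq> 0" using assms by auto
  then have "poly p a * poly p b < 0" using * by (auto simp: sgn_if mult_less_0_iff split: if_splits)
  ultimately show False using poly_IVT assms by (meson less_imp_le)
qed

text \<open>After splitting off the full powers of \<open>x - a\<close> and \<open>x - b\<close>,
  the cofactor \<open>q\<close> has constant sign on the interval. In the derivative one power of
  each factor is lost, and the remaining cofactor \<open>r\<close> has opposite signs at
  \<open>a\<close> and \<open>b\<close>.\<close>

lemma poly_Rolle_consecutive:
  assumes "a < (b::'a)" "poly p a = 0" "poly p b = 0" "p \<noteq> 0"
    and cons: "\<And>x. a < x \<Longrightarrow> x < b \<Longrightarrow> poly p x \<noteq> 0"
  shows "\<exists>c. a < c \<and> c < b \<and> poly (pderiv p) c = 0"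
proof -
  obtain q1 where q1: "p = [:- a, 1:] ^ order a p * q1" "\<not> [:- a, 1:] dvd q1"
    using order_decomp[OF assms(4)] by blast
  then have "q1 \<noteq> 0" by auto
  then obtain q where q: "q1 = [:- b, 1:] ^ order b q1 * q" "\<not> [:- b, 1:] dvd q"
    using order_decomp by blast
  have q1a: "poly q1 a \<noteq> 0" using q1 by (simp add: poly_eq_0_iff_dvd)
  then have qa: "poly q a \<noteq> 0" by (subst (asm) q(1)) auto
  have qb: "poly q b \<noteq> 0" using q by (simp add: poly_eq_0_iff_dvd)
  obtain m where m: "order a p = Suc m" using assms by (metis order_root not0_implies_Suc)
  have "poly q1 b = 0" using assms(1,3) by (subst (asm) q1(1)) auto
  then obtain n where n: "order b q1 = Suc n" using \<open>q1 \<noteq> 0\<close> by (metis order_root not0_implies_Suc)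
  define A B where "A = [:- a, 1:]" "B = [:- b, 1:]"
  have p: "p = A ^ Suc m * (B ^ Suc n * q)" using q1(1) q(1) by (simp add: A_B_def m n)
  have dA: "pderiv A = 1" "pderiv B = 1" by (simp_all add: A_B_def pderiv_pCons)
  define r where "r = smult (of_nat (Suc m)) (B * q) + smult (of_nat (Suc n)) (A * q) + A * B * pderiv q"
  have pd: "pderiv p = A ^ m * B ^ n * r"
  proof -
    have "pderiv (A ^ Suc m) = smult (of_nat (Suc m)) (A ^ m)"
      "pderiv (B ^ Suc n) = smult (of_nat (Suc n)) (B ^ n)"
      by (simp_all only: pderiv_power_Suc dA mult_1_right)
    then show ?thesis
      unfolding p pderiv_mult by (simp add: r_def algebra_simps del: of_nat_Suc)
  qed
  have ev: "poly A x = x - a" "poly B x = x - b" for x by (simp_all add: A_B_def)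
  have "poly q x \<noteq> 0" if "a \<le> x" "x \<le> b" for x
    using cons[of x] qa qb that unfolding p by (cases "x = a"; cases "x = b") auto
  then have s: "sgn (poly q a) = sgn (poly q b)" using poly_sgn_eq[of a b q] assms(1) by simp
  have "poly r a = (of_nat (Suc m) * (a - b)) * poly q a" "poly r b = (of_nat (Suc n) * (b - a)) * poly q b"
    by (simp_all add: r_def ev del: of_nat_Suc)
  moreover have "of_nat (Suc m) * (a - b) < 0" "of_nat (Suc n) * (b - a) > 0"
    using assms(1) by (simp_all add: mult_less_0_iff zero_less_mult_iff del: of_nat_Suc)
  ultimately have "poly r a * poly r b < 0"
    using s qa qb by (auto simp: sgn_if mult_less_0_iff zero_less_mult_iff split: if_splits)
  from poly_IVT[OF assms(1) this] show ?thesis unfolding pd by auto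
qed

lemma poly_Rolle:
  assumes "a < (b::'a)" "poly p a = 0" "poly p b = 0"
  shows "\<exists>c. a < c \<and> c < b \<and> poly (pderiv p) c = 0"
proof (cases "p = 0")
  case True
  then show ?thesis using dense[OF assms(1)] by auto
next
  case False
  \<comment> \<open>The first root after \<open>a\<close> is consecutive to
    \<open>a\<close>.\<close>
  define R where "R = {x. poly p x = 0} \<inter> {a<..b}"
  have R: "finite R" "R \<noteq> {}" using False assms by (auto simp: R_def poly_roots_finite)
  then have "Min R \<in> R" by simp
  moreover have "x \<notin> R" if "x < Min R" for x using Min_le[OF R(1), of x] that by (auto simp: not_le)
  ultimately have "\<exists>c. a < c \<and> c < Min R \<and> poly (pderiv p) c = 0"
    using assms(2) False by (intro poly_Rolle_consecutive) (fastforce simp: R_def)+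
  then show ?thesis using \<open>Min R \<in> R\<close> unfolding R_def
    by (meson IntD2 greaterThanAtMost_iff less_le_trans)
qed

lemma poly_MVT':
  assumes "a < (b::'a)"
  shows "\<exists>c. a < c \<and> c < b \<and> poly p b - poly p a = (b - a) * poly (pderiv p) c"
proof -
  define s where "s = (poly p b - poly p a) / (b - a)"
  have s: "s * (b - a) = poly p b - poly p a" using assms by (simp add: s_def)
  define q where "q = p - [:poly p a - s * a, s:]"
  have "poly q a = 0" "poly q b = 0" using s by (simp_all add: q_def algebra_simps)
  from poly_Rolle[OF assms this] obtain c where "a < c" "c < b" "poly (pderiv q) c = 0" by blast
  moreover have "poly (pderiv q) c = poly (pderiv p) c - s" by (simp add: q_def pderiv_diff pderiv_pCons)
  ultimately show ?thesis using s by (intro exI[of _ c]) (simp add: algebra_simps)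
qed

end

section \<open>Sign-preserving subrings of the square\<close>

text \<open>Applied to differences, the sign condition makes this the graph of an order isomorphism
  between two subrings. As a set of pairs it can be reversed by \<open>converse\<close>, so that
  each argument about domains also covers ranges.\<close>

definition corr :: "('a::linordered_field \<times> 'a) set \<Rightarrow> bool" where
  "corr \<rho> \<longleftrightarrow> (0, 0) \<in> \<rho> \<and> (1, 1) \<in> \<rho> \<and> (\<forall>a b. (a, b) \<in> \<rho> \<longrightarrow> (- a, - b) \<in> \<rho> \<and> sgn a = sgn b) \<and>
    (\<forall>a b c d. (a, b) \<in> \<rho> \<and> (c, d) \<in> \<rho> \<longrightarrow> (a + c, b + d) \<in> \<rho> \<and> (a * c, b * d) \<in> \<rho>)"

lemma corrI:
  assumes "(0, 0) \<in> \<rho>" "(1, 1) \<in> \<rho>" "\<And>a b. (a, b) \<in> \<rho> \<Longrightarrow> (- a, - b) \<in> \<rho>"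
    "\<And>a b. (a, b) \<in> \<rho> \<Longrightarrow> sgn a = sgn b"
    "\<And>a b c d. (a, b) \<in> \<rho> \<Longrightarrow> (c, d) \<in> \<rho> \<Longrightarrow> (a + c, b + d) \<in> \<rho>"
    "\<And>a b c d. (a, b) \<in> \<rho> \<Longrightarrow> (c, d) \<in> \<rho> \<Longrightarrow> (a * c, b * d) \<in> \<rho>"
  shows "corr \<rho>"
  unfolding corr_def by (intro conjI allI impI; (elim conjE)?; rule assms; assumption)

lemma corrD:
  assumes "corr \<rho>"
  shows "(0, 0) \<in> \<rho>" "(1, 1) \<in> \<rho>" "(a, b) \<in> \<rho> \<Longrightarrow> (- a, - b) \<in> \<rho>"
    "(a, b) \<in> \<rho> \<Longrightarrow> (c, d) \<in> \<rho> \<Longrightarrow> (a + c, b + d) \<in> \<rho>"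
    "(a, b) \<in> \<rho> \<Longrightarrow> (c, d) \<in> \<rho> \<Longrightarrow> (a * c, b * d) \<in> \<rho>"
  using assms unfolding corr_def by blast+

lemma corr_sgn: "corr \<rho> \<Longrightarrow> (a, b) \<in> \<rho> \<Longrightarrow> sgn a = sgn b"
  unfolding corr_def by blast

lemma corr_diff: "corr \<rho> \<Longrightarrow> (a, b) \<in> \<rho> \<Longrightarrow> (c, d) \<in> \<rho> \<Longrightarrow> (a - c, b - d) \<in> \<rho>"
  using corrD(4)[of \<rho> a b "- c" "- d"] corrD(3)[of \<rho> c d] by simp

lemma corr_sum: "corr \<rho> \<Longrightarrow> (\<And>i. i \<in> A \<Longrightarrow> (f i, g i) \<in> \<rho>) \<Longrightarrow> (sum f A, sum g A) \<in> \<rho>"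
  by (induction A rule: infinite_finite_induct) (auto intro: corrD)

lemma corr_power: "corr \<rho> \<Longrightarrow> (a, b) \<in> \<rho> \<Longrightarrow> (a ^ n, b ^ n) \<in> \<rho>"
  by (induction n) (auto intro: corrD)

lemma corr_of_nat: "corr \<rho> \<Longrightarrow> (of_nat n, of_nat n) \<in> \<rho>"
  by (induction n) (auto intro: corrD)

lemma corr_abs: "corr \<rho> \<Longrightarrow> (a, b) \<in> \<rho> \<Longrightarrow> (\<bar>a\<bar>, \<bar>b\<bar>) \<in> \<rho>"
  using corr_sgn[of \<rho> a b] corrD(3)[of \<rho> a b] by (metis abs_if sgn_1_neg)

lemma corr_eq_0_iff: "corr \<rho> \<Longrightarrow> (a, b) \<in> \<rho> \<Longrightarrow> a = 0 \<longleftrightarrow> b = 0"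
  using corr_sgn[of \<rho> a b] by (metis sgn_0_0)

lemma corr_sgn_diff: "corr \<rho> \<Longrightarrow> (a, b) \<in> \<rho> \<Longrightarrow> (c, d) \<in> \<rho> \<Longrightarrow> sgn (a - c) = sgn (b - d)"
  using corr_sgn[OF _ corr_diff] .

lemma corr_less_iff: "corr \<rho> \<Longrightarrow> (a, b) \<in> \<rho> \<Longrightarrow> (c, d) \<in> \<rho> \<Longrightarrow> a < c \<longleftrightarrow> b < d"
  using corr_sgn_diff[of \<rho> a b c d] by (metis diff_less_0_iff_less sgn_1_neg)

lemma corr_converse: "corr \<rho> \<Longrightarrow> corr (\<rho>\<inverse>)"
  by (rule corrI) (simp_all add: corrD corr_sgn)

section \<open>Polynomials with corresponding coefficients\<close>

definition pcorr :: "('a::linordered_field \<times> 'a) set \<Rightarrow> 'a poly \<Rightarrow> 'a poly \<Rightarrow> bool" where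
  "pcorr \<rho> p q \<longleftrightarrow> (\<forall>i. (coeff p i, coeff q i) \<in> \<rho>)"

lemma pcorr_coeff: "pcorr \<rho> p q \<Longrightarrow> (coeff p i, coeff q i) \<in> \<rho>"
  unfolding pcorr_def by blast

lemma pcorr_converse: "pcorr (\<rho>\<inverse>) p q \<longleftrightarrow> pcorr \<rho> q p"
  unfolding pcorr_def by simp

lemma pcorr_degree: "corr \<rho> \<Longrightarrow> pcorr \<rho> p q \<Longrightarrow> degree p = degree q"
proof -
  assume \<rho>: "corr \<rho>" and pq: "pcorr \<rho> p q"
  then have "coeff p i = 0 \<longleftrightarrow> coeff q i = 0" for i
    by (intro corr_eq_0_iff pcorr_coeff)
  then show ?thesis by (metis degree_le coeff_eq_0 dual_order.antisym)
qed

lemma pcorr_eq_0_iff: "corr \<rho> \<Longrightarrow> pcorr \<rho> p q \<Longrightarrow> p = 0 \<longleftrightarrow> q = 0"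
  using corr_eq_0_iff[OF _ pcorr_coeff] pcorr_degree by (metis leading_coeff_0_iff)

lemma pcorr_0: "corr \<rho> \<Longrightarrow> pcorr \<rho> 0 0"
  unfolding pcorr_def by (simp add: corrD)

lemma pcorr_pCons: "(a, b) \<in> \<rho> \<Longrightarrow> pcorr \<rho> p q \<Longrightarrow> pcorr \<rho> (pCons a p) (pCons b q)"
  unfolding pcorr_def by (simp add: coeff_pCons split: nat.split)

lemma pcorr_const: "corr \<rho> \<Longrightarrow> (a, b) \<in> \<rho> \<Longrightarrow> pcorr \<rho> [:a:] [:b:]"
  by (intro pcorr_pCons pcorr_0)

lemma pcorr_X: "corr \<rho> \<Longrightarrow> pcorr \<rho> [:0, 1:] [:0, 1:]"
  by (intro pcorr_pCons pcorr_0 corrD)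

lemma pcorr_minus: "corr \<rho> \<Longrightarrow> pcorr \<rho> p q \<Longrightarrow> pcorr \<rho> (- p) (- q)"
  unfolding pcorr_def by (simp add: corrD)

lemma pcorr_add: "corr \<rho> \<Longrightarrow> pcorr \<rho> p q \<Longrightarrow> pcorr \<rho> r s \<Longrightarrow> pcorr \<rho> (p + r) (q + s)"
  unfolding pcorr_def by (simp add: corrD)

lemma pcorr_diff: "corr \<rho> \<Longrightarrow> pcorr \<rho> p q \<Longrightarrow> pcorr \<rho> r s \<Longrightarrow> pcorr \<rho> (p - r) (q - s)"
  unfolding pcorr_def by (simp add: corr_diff)

lemma pcorr_mult: "corr \<rho> \<Longrightarrow> pcorr \<rho> p q \<Longrightarrow> pcorr \<rho> r s \<Longrightarrow> pcorr \<rho> (p * r) (q * s)"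
  unfolding pcorr_def coeff_mult by (intro allI corr_sum corrD(5)) simp_all

lemma pcorr_monom: "corr \<rho> \<Longrightarrow> (a, b) \<in> \<rho> \<Longrightarrow> pcorr \<rho> (monom a n) (monom b n)"
  unfolding pcorr_def by (simp add: corrD)

lemma pcorr_pderiv: "corr \<rho> \<Longrightarrow> pcorr \<rho> p q \<Longrightarrow> pcorr \<rho> (pderiv p) (pderiv q)"
  unfolding pcorr_def by (simp add: coeff_pderiv corrD corr_of_nat del: of_nat_Suc)

lemma pcorr_poly:
  assumes "corr \<rho>" "pcorr \<rho> p q" "(x, y) \<in> \<rho>"
  shows "(poly p x, poly q y) \<in> \<rho>"
  unfolding poly_altdef pcorr_degree[OF assms(1,2)]
  by (intro corr_sum corrD(5) corr_power pcorr_coeff assms)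

section \<open>Adjoining a pair, maximality and field operations\<close>

definition adjoin :: "('a::linordered_field \<times> 'a) set \<Rightarrow> 'a \<Rightarrow> 'a \<Rightarrow> ('a \<times> 'a) set" where
  "adjoin \<rho> x y = {(poly p x, poly q y) | p q. pcorr \<rho> p q}"

text \<open>Closure under the ring operations is inherited from corresponding polynomials; only the
  sign condition has to be supplied.\<close>

lemma corr_adjoin:
  assumes \<rho>: "corr \<rho>" and sgn: "\<And>p q. pcorr \<rho> p q \<Longrightarrow> sgn (poly p x) = sgn (poly q y)"
  shows "corr (adjoin \<rho> x y)" "\<rho> \<subseteq> adjoin \<rho> x y" "(x, y) \<in> adjoin \<rho> x y"
proof -
  have I: "pcorr \<rho> p q \<Longrightarrow> (poly p x, poly q y) \<in> adjoin \<rho> x y" for p q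
    unfolding adjoin_def by blast
  show sub: "\<rho> \<subseteq> adjoin \<rho> x y"
  proof safe
    fix a b assume "(a, b) \<in> \<rho>"
    then show "(a, b) \<in> adjoin \<rho> x y" using I[OF pcorr_const[OF \<rho>], of a b] by simp
  qed
  show "(x, y) \<in> adjoin \<rho> x y" using I[OF pcorr_X[OF \<rho>]] by simp
  show "corr (adjoin \<rho> x y)"
  proof (rule corrI)
    show "(0, 0) \<in> adjoin \<rho> x y" "(1, 1) \<in> adjoin \<rho> x y" using sub corrD[OF \<rho>] by auto
    fix a b assume "(a, b) \<in> adjoin \<rho> x y"
    then obtain p q where pq: "pcorr \<rho> p q" "a = poly p x" "b = poly q y" unfolding adjoin_def by blast
    show "(- a, - b) \<in> adjoin \<rho> x y" using I[OF pcorr_minus[OF \<rho> pq(1)]] pq by simp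
    show "sgn a = sgn b" using sgn pq by simp
    fix c d assume "(c, d) \<in> adjoin \<rho> x y"
    then obtain r s where rs: "pcorr \<rho> r s" "c = poly r x" "d = poly s y" unfolding adjoin_def by blast
    show "(a + c, b + d) \<in> adjoin \<rho> x y" using I[OF pcorr_add[OF \<rho> pq(1) rs(1)]] pq rs by simp
    show "(a * c, b * d) \<in> adjoin \<rho> x y" using I[OF pcorr_mult[OF \<rho> pq(1) rs(1)]] pq rs by simp
  qed
qed

definition maximal_corr :: "('a::linordered_field \<times> 'a) set \<Rightarrow> bool" where
  "maximal_corr \<rho> \<longleftrightarrow> corr \<rho> \<and> (\<forall>\<sigma>. corr \<sigma> \<and> \<rho> \<subseteq> \<sigma> \<longrightarrow> \<sigma> = \<rho>)"

lemma maximal_corr_exists: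
  assumes "corr \<rho>"
  shows "\<exists>\<sigma>. \<rho> \<subseteq> \<sigma> \<and> maximal_corr \<sigma>"
proof -
  let ?A = "{\<sigma>. corr \<sigma> \<and> \<rho> \<subseteq> \<sigma>}"
  have "\<Union>C \<in> ?A" if "C \<noteq> {}" "subset.chain ?A C" for C
  proof -
    have C: "corr \<sigma>" "\<rho> \<subseteq> \<sigma>" if "\<sigma> \<in> C" for \<sigma> using \<open>subset.chain ?A C\<close> that unfolding subset.chain_def by auto
    have two: "\<exists>\<sigma>\<in>C. u \<in> \<sigma> \<and> v \<in> \<sigma>" if "u \<in> \<Union>C" "v \<in> \<Union>C" for u v
      using that \<open>subset.chain ?A C\<close> unfolding subset.chain_def by blast
    have "corr (\<Union>C)"
    proof (rule corrI)
      obtain \<sigma> where "\<sigma> \<in> C" using \<open>C \<noteq> {}\<close> by blast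
      then show "(0, 0) \<in> \<Union>C" "(1, 1) \<in> \<Union>C" using C corrD by blast+
    next
      fix a b assume "(a, b) \<in> \<Union>C"
      then show "(- a, - b) \<in> \<Union>C" "sgn a = sgn b" using C corrD(3) corr_sgn by blast+
    next
      fix a b c d assume "(a, b) \<in> \<Union>C" "(c, d) \<in> \<Union>C"
      then obtain \<sigma> where "\<sigma> \<in> C" "(a, b) \<in> \<sigma>" "(c, d) \<in> \<sigma>" using two by meson
      then show "(a + c, b + d) \<in> \<Union>C" "(a * c, b * d) \<in> \<Union>C" using C(1) corrD(4,5) by blast+
    qed
    then show ?thesis using C(2) \<open>C \<noteq> {}\<close> by blast
  qed
  then obtain M where "M \<in> ?A" "\<forall>\<sigma>\<in>?A. M \<subseteq> \<sigma> \<longrightarrow> \<sigma> = M"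
    using subset_Zorn_nonempty[of ?A] assms by auto
  then have "maximal_corr M" "\<rho> \<subseteq> M" unfolding maximal_corr_def by auto
  then show ?thesis by blast
qed

lemma maximal_corr_converse: "maximal_corr \<rho> \<Longrightarrow> maximal_corr (\<rho>\<inverse>)"
  unfolding maximal_corr_def by (metis converse_converse converse_mono corr_converse)

text \<open>This is how maximality is used: membership of a pair is reduced to a comparison of signs
  of polynomials.\<close>

lemma maximal_corr_adjoin:
  assumes "maximal_corr \<rho>" "\<And>p q. pcorr \<rho> p q \<Longrightarrow> sgn (poly p x) = sgn (poly q y)"
  shows "(x, y) \<in> \<rho>"
  using corr_adjoin[of \<rho> x y] assms unfolding maximal_corr_def by metis

text \<open>Multiplying the value at an inverse by the power with exponent
  \<open>2 * degree p\<close> clears denominators, and the even exponent keeps the sign.\<close>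

lemma maximal_corr_inverse:
  assumes max: "maximal_corr \<rho>" and ab: "(a, b) \<in> \<rho>"
  shows "(inverse a, inverse b) \<in> \<rho>"
proof (cases "a = 0")
  case True
  then show ?thesis using max ab corr_eq_0_iff unfolding maximal_corr_def by fastforce
next
  case False
  have \<rho>: "corr \<rho>" using max unfolding maximal_corr_def by blast
  then have "b \<noteq> 0" using False ab corr_eq_0_iff by blast
  have ev: "c ^ (2 * degree p) * poly p (inverse c) = (\<Sum>i\<le>degree p. coeff p i * c ^ (2 * degree p - i))"
    if "c \<noteq> 0" for c :: 'a and p
  proof -
    have "c ^ (2 * degree p) * inverse c ^ i = c ^ (2 * degree p - i)" if "i \<le> degree p" for i
      using that \<open>c \<noteq> 0\<close> by (simp add: power_diff divide_simps)
    then show ?thesis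
      unfolding poly_altdef sum_distrib_left by (intro sum.cong) (auto simp: mult.left_commute)
  qed
  have s: "sgn (c ^ (2 * n) * z) = sgn z" if "c \<noteq> 0" for c z :: 'a and n
  proof -
    have "c ^ (2 * n) > 0" using that by (simp add: power_mult zero_less_power)
    then have "sgn (c ^ (2 * n)) = 1" by (rule sgn_pos)
    then show ?thesis by (simp only: sgn_mult mult_1_left)
  qed
  show ?thesis
  proof (rule maximal_corr_adjoin[OF max])
    fix p q assume pq: "pcorr \<rho> p q"
    then have deg: "degree q = degree p" using pcorr_degree[OF \<rho>] by simp
    have "(\<Sum>i\<le>degree p. coeff p i * a ^ (2 * degree p - i), \<Sum>i\<le>degree p. coeff q i * b ^ (2 * degree p - i)) \<in> \<rho>"
      by (intro corr_sum corrD(5) corr_power pcorr_coeff \<rho> ab pq)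
    then have "(a ^ (2 * degree p) * poly p (inverse a), b ^ (2 * degree p) * poly q (inverse b)) \<in> \<rho>"
      using ev[OF False, of p] ev[OF \<open>b \<noteq> 0\<close>, of q] deg by simp
    from corr_sgn[OF \<rho> this] show "sgn (poly p (inverse a)) = sgn (poly q (inverse b))"
      using s False \<open>b \<noteq> 0\<close> by simp
  qed
qed

text \<open>A larger \<open>x\<close> would exceed both 1 and the sum, and then the leading term
  outweighs all others. The bound uses only ring operations, absolute values and an inverse, all of
  which a maximal correspondence respects.\<close>

lemma Cauchy_root_bound:
  fixes p :: "'a::linordered_field poly"
  assumes "p \<noteq> 0" "poly p x = 0"
  shows "\<bar>x\<bar> < 2 + (\<Sum>i<degree p. \<bar>coeff p i * inverse (lead_coeff p)\<bar>)" (is "_ < 2 + ?s")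
proof (rule ccontr)
  assume not_less: "\<not> \<bar>x\<bar> < 2 + ?s"
  have "?s \<ge> 0" by (intro sum_nonneg) simp
  then have x: "\<bar>x\<bar> > 1" "\<bar>x\<bar> > ?s" using not_less by linarith+
  have lc: "lead_coeff p \<noteq> 0" using assms by simp
  have "degree p \<noteq> 0"
  proof
    assume "degree p = 0"
    then obtain c where "p = [:c:]" by (rule degree_eq_zeroE)
    then show False using assms by simp
  qed
  then obtain n where n: "degree p = Suc n" by (metis not0_implies_Suc)
  have "poly p x = (\<Sum>i<Suc n. coeff p i * x ^ i) + lead_coeff p * x ^ Suc n"
    unfolding poly_altdef by (simp add: n lessThan_Suc_atMost del: power_Suc)
  then have "lead_coeff p * x ^ Suc n = - (\<Sum>i<Suc n. coeff p i * x ^ i)"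
    using assms(2) by (simp add: eq_neg_iff_add_eq_0 add.commute)
  then have "x ^ Suc n = - (\<Sum>i<Suc n. coeff p i * x ^ i) * inverse (lead_coeff p)"
    using lc by (simp add: field_simps del: power_Suc)
  also have "\<dots> = - (\<Sum>i<Suc n. coeff p i * inverse (lead_coeff p) * x ^ i)"
    by (simp add: sum_distrib_right mult.assoc mult.commute[of "inverse _"] del: sum.lessThan_Suc)
  finally have e: "x ^ Suc n = - (\<Sum>i<Suc n. coeff p i * inverse (lead_coeff p) * x ^ i)" .
  have "\<bar>x\<bar> ^ Suc n = \<bar>\<Sum>i<Suc n. coeff p i * inverse (lead_coeff p) * x ^ i\<bar>"
    unfolding power_abs[symmetric] e by (rule abs_minus_cancel)
  also have "\<dots> \<le> (\<Sum>i<Suc n. \<bar>coeff p i * inverse (lead_coeff p) * x ^ i\<bar>)" by (rule sum_abs)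
  also have "\<dots> \<le> (\<Sum>i<Suc n. \<bar>coeff p i * inverse (lead_coeff p)\<bar> * \<bar>x\<bar> ^ n)"
    using x(1) by (intro sum_mono) (auto simp: abs_mult power_abs intro!: mult_left_mono power_increasing)
  also have "\<dots> = ?s * \<bar>x\<bar> ^ n" by (simp only: sum_distrib_right n)
  also have "\<dots> < \<bar>x\<bar> * \<bar>x\<bar> ^ n" using x by (intro mult_strict_right_mono zero_less_power) auto
  finally show False by simp
qed

section \<open>Closure under roots\<close>

text \<open>The degree bound is strict so that \<open>root_closed (degree p)\<close> is just the
  induction hypothesis for roots of \<open>p\<close>.\<close>

definition root_closed :: "nat \<Rightarrow> ('a::linordered_field \<times> 'a) set \<Rightarrow> bool" where
  "root_closed d \<rho> \<longleftrightarrow> (\<forall>p q. pcorr \<rho> p q \<and> p \<noteq> 0 \<and> degree p < d \<longrightarrow>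
    (\<forall>x. poly p x = 0 \<longrightarrow> x \<in> Domain \<rho>) \<and> (\<forall>y. poly q y = 0 \<longrightarrow> y \<in> Range \<rho>))"

lemma root_closedD:
  assumes "root_closed d \<rho>" "pcorr \<rho> p q" "p \<noteq> 0" "degree p < d"
  shows "poly p x = 0 \<Longrightarrow> x \<in> Domain \<rho>" "poly q y = 0 \<Longrightarrow> y \<in> Range \<rho>"
  using assms unfolding root_closed_def by blast+

lemma root_closed_converse:
  assumes "corr \<rho>" "root_closed d \<rho>"
  shows "root_closed d (\<rho>\<inverse>)"
  unfolding root_closed_def
proof (intro allI impI)
  fix p q assume "pcorr (\<rho>\<inverse>) p q \<and> p \<noteq> 0 \<and> degree p < d"
  then have *: "pcorr \<rho> q p" "q \<noteq> 0" "degree q < d"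
    using pcorr_degree[of \<rho> q p] pcorr_eq_0_iff[of \<rho> q p] assms(1) by (simp_all add: pcorr_converse)
  show "(\<forall>x. poly p x = 0 \<longrightarrow> x \<in> Domain (\<rho>\<inverse>)) \<and> (\<forall>y. poly q y = 0 \<longrightarrow> y \<in> Range (\<rho>\<inverse>))"
    using root_closedD[OF assms(2) *] by simp
qed

lemma maximal_corr_midpoint:
  assumes "maximal_corr \<rho>" "(a, b) \<in> \<rho>" "(c, d) \<in> \<rho>"
  shows "((a + c) * inverse 2, (b + d) * inverse 2) \<in> \<rho>"
proof -
  have \<rho>: "corr \<rho>" using assms(1) unfolding maximal_corr_def by simp
  have "(2, 2) \<in> \<rho>" using corr_of_nat[OF \<rho>, of 2] by simp
  then have "(inverse 2, inverse 2) \<in> \<rho>" by (rule maximal_corr_inverse[OF assms(1)])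
  then show ?thesis using \<rho> assms(2,3) by (intro corrD(4,5))
qed

text \<open>The midpoint of the neighbors of \<open>x\<close> in \<open>Z\<close> lies in the
  domain; if \<open>x\<close> is beyond all of \<open>Z\<close>, the extreme element shifted by 1
  does, and if \<open>Z\<close> is empty, 0 does. The point \<open>m\<close> then stands in for
  \<open>x\<close>.\<close>

lemma maximal_corr_sample:
  fixes x :: "'a::linordered_field"
  assumes max: "maximal_corr \<rho>" and Z: "finite Z" "Z \<subseteq> Domain \<rho>" "x \<notin> Z"
  shows "\<exists>m\<in>Domain \<rho>. \<forall>z\<in>Z. sgn (z - m) = sgn (z - x)"
proof -
  have \<rho>: "corr \<rho>" using max unfolding maximal_corr_def by simp
  define L U where "L = {z\<in>Z. z < x}" "U = {z\<in>Z. x < z}"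
  have fin: "finite L" "finite U" using Z by (auto simp: L_U_def)
  have split: "z \<in> L \<or> z \<in> U" if "z \<in> Z" for z using that Z(3) by (auto simp: L_U_def not_less_iff_gr_or_eq)
  have "\<exists>m\<in>Domain \<rho>. (\<forall>z\<in>L. z < m) \<and> (\<forall>z\<in>U. m < z)"
  proof (cases "L = {}"; cases "U = {}")
    assume "L = {}" "U = {}"
    then show ?thesis using corrD(1)[OF \<rho>] by auto
  next
    assume "L \<noteq> {}" "U = {}"
    then have "Max L \<in> L" using fin by simp
    then obtain b where "(Max L, b) \<in> \<rho>" using Z(2) by (auto simp: L_U_def)
    then have "Max L + 1 \<in> Domain \<rho>" using corrD(2,4)[OF \<rho>] by blast
    moreover have "z < Max L + 1" if "z \<in> L" for z using Max_ge[OF fin(1) that] by simp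
    ultimately show ?thesis using \<open>U = {}\<close> by blast
  next
    assume "L = {}" "U \<noteq> {}"
    then have "Min U \<in> U" using fin by simp
    then obtain b where "(Min U, b) \<in> \<rho>" using Z(2) by (auto simp: L_U_def)
    then have "Min U - 1 \<in> Domain \<rho>" using corr_diff[OF \<rho>] corrD(2)[OF \<rho>] by blast
    moreover have "Min U - 1 < z" if "z \<in> U" for z
      using Min_le[OF fin(2) that] by (meson diff_less less_le_trans less_add_one zero_less_one diff_less_eq le_less_trans)
    ultimately show ?thesis using \<open>L = {}\<close> by blast
  next
    assume "L \<noteq> {}" "U \<noteq> {}"
    then have mem: "Max L \<in> L" "Min U \<in> U" using fin by simp_all
    then have "Max L \<in> Domain \<rho>" "Min U \<in> Domain \<rho>" using Z(2) unfolding L_U_def by blast+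
    then obtain b d where "(Max L, b) \<in> \<rho>" "(Min U, d) \<in> \<rho>" by blast
    from maximal_corr_midpoint[OF max this] have D: "(Max L + Min U) * inverse 2 \<in> Domain \<rho>" by blast
    have lt: "Max L < Min U" using mem by (auto simp: L_U_def)
    have m: "Max L < (Max L + Min U) * inverse 2" "(Max L + Min U) * inverse 2 < Min U"
      using lt by (simp_all add: field_simps)
    have "z < (Max L + Min U) * inverse 2" if "z \<in> L" for z using Max_ge[OF fin(1) that] m(1) by (rule le_less_trans)
    moreover have "(Max L + Min U) * inverse 2 < z" if "z \<in> U" for z
      using m(2) Min_le[OF fin(2) that] by (rule less_le_trans)
    ultimately show ?thesis using D by blast
  qed
  then obtain m where "m \<in> Domain \<rho>" and m: "\<And>z. z \<in> L \<Longrightarrow> z < m" "\<And>z. z \<in> U \<Longrightarrow> m < z" by blast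
  have "sgn (z - m) = sgn (z - x)" if "z \<in> Z" for z
    using split[OF that] m[of z] by (auto simp: L_U_def sgn_if)
  then show ?thesis using \<open>m \<in> Domain \<rho>\<close> by blast
qed

text \<open>Cauchy's bounds for \<open>p\<close> and \<open>q\<close> correspond, so the one for
  \<open>p\<close> lies in the domain.\<close>

lemma maximal_corr_bound:
  assumes max: "maximal_corr \<rho>" and pq: "pcorr \<rho> p q" and "p \<noteq> 0" "poly p x = 0"
  shows "\<exists>M\<in>Domain \<rho>. - M \<in> Domain \<rho> \<and> - M < x \<and> x < M"
proof -
  have \<rho>: "corr \<rho>" using max unfolding maximal_corr_def by simp
  define B where "B p = 2 + (\<Sum>i<degree p. \<bar>coeff p i * inverse (lead_coeff p)\<bar>)" for p :: "'a poly"
  have "(2, 2) \<in> \<rho>" using corr_of_nat[OF \<rho>, of 2] by simp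
  moreover have "(lead_coeff p, lead_coeff q) \<in> \<rho>"
    using pcorr_coeff[OF pq, of "degree p"] pcorr_degree[OF \<rho> pq] by simp
  moreover note deg = pcorr_degree[OF \<rho> pq]
  ultimately have "(B p, B q) \<in> \<rho>"
    unfolding B_def deg[symmetric]
    by (intro corrD(4,5) corr_sum corr_abs maximal_corr_inverse[OF max] pcorr_coeff[OF pq] \<rho>)
  then have "B p \<in> Domain \<rho>" "- B p \<in> Domain \<rho>" using corrD(3)[OF \<rho>] by blast+
  moreover have "\<bar>x\<bar> < B p" unfolding B_def by (rule Cauchy_root_bound[OF assms(3,4)])
  then have "- B p < x" "x < B p" by (simp_all add: abs_less_iff)
  ultimately show ?thesis by blast
qed

text \<open>Division with remainder carried out on both sides at once: corresponding multiples of
  \<open>p\<close> and \<open>q\<close> cancel the leading terms, and they vanish at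
  \<open>x\<close> and \<open>y\<close>. Signs then need to be compared only below the degree of
  \<open>p\<close>.\<close>

lemma pcorr_reduce:
  assumes max: "maximal_corr \<rho>" and pq: "pcorr \<rho> p q" "p \<noteq> 0" "degree p > 0"
    and roots: "poly p x = 0" "poly q y = 0" and rs: "pcorr \<rho> r s"
  shows "\<exists>r' s'. pcorr \<rho> r' s' \<and> degree r' < degree p \<and> poly r' x = poly r x \<and> poly s' y = poly s y"
  using rs
proof (induction "degree r" arbitrary: r s rule: less_induct)
  case less
  have \<rho>: "corr \<rho>" using max unfolding maximal_corr_def by simp
  show ?case
  proof (cases "degree r < degree p")
    case True
    then show ?thesis using less.prems by blast
  next
    case False
    note d = pcorr_degree[OF \<rho> pq(1)] pcorr_degree[OF \<rho> less.prems]
    define k where "k = degree r - degree p"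
    define c where "c = lead_coeff r * inverse (lead_coeff p)"
    define c' where "c' = lead_coeff s * inverse (lead_coeff q)"
    have "(lead_coeff r, lead_coeff s) \<in> \<rho>" "(lead_coeff p, lead_coeff q) \<in> \<rho>"
      using pcorr_coeff[OF less.prems, of "degree r"] pcorr_coeff[OF pq(1), of "degree p"] d by simp_all
    then have c: "(c, c') \<in> \<rho>" unfolding c_def c'_def by (intro corrD(5) \<rho> maximal_corr_inverse[OF max])
    define r' where "r' = r - monom c k * p"
    define s' where "s' = s - monom c' k * q"
    have rs': "pcorr \<rho> r' s'"
      unfolding r'_def s'_def by (intro pcorr_diff pcorr_mult pcorr_monom c \<rho> pq less.prems)
    have "lead_coeff p \<noteq> 0" using pq by simp
    have le: "degree (monom c k * p) \<le> degree r"
      using degree_mult_le[of "monom c k" p] degree_monom_le[of c k] False unfolding k_def by linarith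
    have top: "coeff (monom c k * p) (degree r) = coeff r (degree r)"
      using False \<open>lead_coeff p \<noteq> 0\<close> unfolding coeff_monom_mult by (simp add: k_def c_def)
    have "degree r' < degree r"
    proof (rule ccontr)
      assume "\<not> degree r' < degree r"
      moreover have "degree r' \<le> degree r" unfolding r'_def by (intro degree_diff_le le) simp
      ultimately have "degree r' = degree r" by simp
      moreover have "coeff r' (degree r) = 0" unfolding r'_def by (simp add: top)
      ultimately have "r' = 0" by (metis leading_coeff_0_iff)
      then show False using \<open>degree r' = degree r\<close> False pq(3) by simp
    qed
    from less.hyps[OF this rs'] show ?thesis by (simp add: r'_def s'_def roots)
  qed
qed

section \<open>Signs of polynomials, cuts and roots\<close>

context poly_IVT_field
begin

lemma poly_sgn_eq':
  assumes "\<And>z. poly p z = 0 \<Longrightarrow> sgn (z - a) = sgn (z - b)"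
  shows "sgn (poly p a) = sgn (poly p (b :: 'a))"
proof -
  have *: "sgn (poly p a) = sgn (poly p b)"
    if "a \<le> b" "\<And>z. poly p z = 0 \<Longrightarrow> sgn (z - a) = sgn (z - b)" for a b :: 'a
  proof (cases "a = b")
    case False
    show ?thesis
    proof (rule poly_sgn_eq[OF \<open>a \<le> b\<close>])
      fix z assume z: "a \<le> z" "z \<le> b"
      show "poly p z \<noteq> 0"
      proof
        assume "poly p z = 0"
        then have "sgn (z - a) = sgn (z - b)" by (rule that(2))
        with z False show False by (auto simp: sgn_if split: if_splits)
      qed
    qed
  qed simp
  show ?thesis
  proof (cases "a \<le> b")
    case True
    then show ?thesis using * assms by blast
  next
    case False
    then show ?thesis using *[of b a] assms by simp
  qed
qed

text \<open>By the mean value theorem, since the derivative has constant sign on the open interval.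
  The point \<open>g\<close> may be an endpoint because the intermediate point is strictly
  inside.\<close>

lemma poly_sgn_near_root:
  assumes "l < x" "x < (u::'a)" "poly p x = 0" "\<And>z. l < z \<Longrightarrow> z < u \<Longrightarrow> poly (pderiv p) z \<noteq> 0"
    and g: "l \<le> g" "g \<le> u"
  shows "sgn (poly p g) = sgn (poly (pderiv p) x) * sgn (g - x)"
proof -
  have const: "sgn (poly (pderiv p) c) = sgn (poly (pderiv p) x)" if "l < c" "c < u" for c
  proof (cases "c \<le> x")
    case True
    then show ?thesis using assms(1,2,4) that by (intro poly_sgn_eq) auto
  next
    case False
    then show ?thesis using assms(1,2,4) that by (intro poly_sgn_eq[symmetric]) auto
  qed
  consider "g < x" | "g = x" | "x < g" by (rule linorder_cases)
  then show ?thesis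
  proof cases
    case 1
    obtain c where c: "g < c" "c < x" "poly p x - poly p g = (x - g) * poly (pderiv p) c"
      using poly_MVT'[OF 1] by blast
    then have "- poly p g = (x - g) * poly (pderiv p) c" using assms(3) by simp
    then have "poly p g = - (x - g) * poly (pderiv p) c" by (metis minus_mult_left minus_minus)
    then have "sgn (poly p g) = sgn (g - x) * sgn (poly (pderiv p) c)" by (simp only: minus_diff_eq sgn_mult)
    moreover have "sgn (poly (pderiv p) c) = sgn (poly (pderiv p) x)"
      using c(1,2) g assms(1,2) by (intro const) linarith+
    ultimately show ?thesis by (simp only: mult.commute)
  next
    case 2
    then show ?thesis using assms by simp
  next
    case 3
    obtain c where c: "x < c" "c < g" "poly p g - poly p x = (g - x) * poly (pderiv p) c"
      using poly_MVT'[OF 3] by blast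
    then have "poly p g = (g - x) * poly (pderiv p) c" using assms(3) by simp
    then have "sgn (poly p g) = sgn (g - x) * sgn (poly (pderiv p) c)" by (simp only: sgn_mult)
    moreover have "sgn (poly (pderiv p) c) = sgn (poly (pderiv p) x)"
      using c(1,2) g assms(1,2) by (intro const) linarith+
    ultimately show ?thesis by (simp only: mult.commute)
  qed
qed

text \<open>A pair \<open>(m, m')\<close> carries the sign across: \<open>m\<close> lies like
  \<open>x\<close> among the roots of \<open>r\<close>, and since every root of \<open>s\<close> is
  the partner of a root of \<open>r\<close>, \<open>m'\<close> lies like \<open>y\<close> among the
  roots of \<open>s\<close>.\<close>

lemma cut_sgn:
  fixes x y :: 'a
  assumes max: "maximal_corr \<rho>" and rs: "pcorr \<rho> r s" and "r \<noteq> 0"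
    and roots: "\<And>z. poly r z = 0 \<Longrightarrow> z \<in> Domain \<rho>" "\<And>z. poly s z = 0 \<Longrightarrow> z \<in> Range \<rho>"
    and x: "x \<notin> Domain \<rho>" and cut: "\<And>a b. (a, b) \<in> \<rho> \<Longrightarrow> sgn (a - x) = sgn (b - y)"
  shows "sgn (poly r x) = sgn (poly s y)"
proof -
  have \<rho>: "corr \<rho>" using max unfolding maximal_corr_def by simp
  define Z where "Z = {z. poly r z = 0}"
  have "finite Z" "Z \<subseteq> Domain \<rho>" "x \<notin> Z"
    using \<open>r \<noteq> 0\<close> roots(1) x by (auto simp: Z_def poly_roots_finite)
  from maximal_corr_sample[OF max this] obtain m m' where
    m: "(m, m') \<in> \<rho>" "\<And>z. z \<in> Z \<Longrightarrow> sgn (z - m) = sgn (z - x)" by blast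
  have "sgn (poly r x) = sgn (poly r m)"
    by (rule poly_sgn_eq') (simp add: m Z_def)
  also have "\<dots> = sgn (poly s m')" by (intro corr_sgn[OF \<rho>] pcorr_poly \<rho> rs m)
  also have "\<dots> = sgn (poly s y)"
  proof (rule poly_sgn_eq')
    fix b assume b: "poly s b = 0"
    then obtain a where a: "(a, b) \<in> \<rho>" using roots(2) by blast
    then have "a \<in> Z" using corr_eq_0_iff[OF \<rho> pcorr_poly[OF \<rho> rs a]] b by (simp add: Z_def)
    have "sgn (b - m') = sgn (a - m)" using corr_sgn_diff[OF \<rho> a m(1)] by simp
    also have "\<dots> = sgn (a - x)" by (rule m) fact
    also have "\<dots> = sgn (b - y)" by (rule cut[OF a])
    finally show "sgn (b - m') = sgn (b - y)" .
  qed
  finally show ?thesis .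
qed

text \<open>
  Minimality of the degree puts the critical points of \<open>p\<close> into the domain of \<open>\<rho>\<close>, so that \<open>x\<close> is
  separated from them by an interval with endpoints in the domain. The corresponding interval
  contains exactly one root of \<open>q\<close>, and this root lies in the same cut as \<open>x\<close>.
\<close>
lemma root_closed_step:
  fixes x :: 'a
  assumes max: "maximal_corr \<rho>" and closed: "root_closed (degree p) \<rho>"
    and pq: "pcorr \<rho> p q" "p \<noteq> 0" and x: "poly p x = 0"
  shows "x \<in> Domain \<rho>"
proof (rule ccontr)
  assume nx: "x \<notin> Domain \<rho>"
  have \<rho>: "corr \<rho>" using max unfolding maximal_corr_def by simp
  have deg: "degree p > 0"
  proof (rule ccontr)
    assume "\<not> degree p > 0"
    then obtain c where "p = [:c:]" by (auto elim: degree_eq_zeroE)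
    then show False using x pq(2) by simp
  qed
  note pq' = pcorr_pderiv[OF \<rho> pq(1)]
  have dp: "pderiv p \<noteq> 0" using deg by (simp add: pderiv_eq_0_iff)
  have degd: "degree (pderiv p) < degree p" using deg by (simp add: degree_pderiv)
  note crit = root_closedD[OF closed pq' dp degd]
  obtain M where M: "M \<in> Domain \<rho>" "- M \<in> Domain \<rho>" "- M < x" "x < M"
    using maximal_corr_bound[OF max pq x] by blast
  \<comment> \<open>The bounds \<open>M\<close> and \<open>- M\<close> ensure that \<open>Z\<close>
    has elements on both sides of \<open>x\<close>.\<close>
  define Z where "Z = {z. poly (pderiv p) z = 0} \<union> {M, - M}"
  have Z: "finite Z" "Z \<subseteq> Domain \<rho>" using dp crit(1) M by (auto simp: Z_def poly_roots_finite)
  define l u where "l = Max {z\<in>Z. z < x}" "u = Min {z\<in>Z. x < z}"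
  have L: "finite {z\<in>Z. z < x}" "{z\<in>Z. z < x} \<noteq> {}" and U: "finite {z\<in>Z. x < z}" "{z\<in>Z. x < z} \<noteq> {}"
    using Z M by (auto simp: Z_def)
  have l: "l \<in> Z" "l < x" and u: "u \<in> Z" "x < u"
    using Max_in[OF L] Min_in[OF U] unfolding l_u_def by auto
  have free: "poly (pderiv p) z \<noteq> 0" if "l < z" "z < u" for z
  proof
    assume "poly (pderiv p) z = 0"
    then have "z \<in> Z" "z \<noteq> x" using nx crit(1) by (auto simp: Z_def)
    then show False
      using Max_ge[OF L(1), of z] Min_le[OF U(1), of z] that unfolding l_u_def
      by (cases "z < x") (auto simp: not_less)
  qed
  obtain l' u' where lu: "(l, l') \<in> \<rho>" "(u, u') \<in> \<rho>" using l u Z by blast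
  have near: "sgn (poly p g) = sgn (poly (pderiv p) x) * sgn (g - x)" if "l \<le> g" "g \<le> u" for g
    using l u x free that by (intro poly_sgn_near_root)
  have "sgn (poly p l) * sgn (poly p u) = sgn (poly (pderiv p) x) * sgn (poly (pderiv p) x) * (sgn (l - x) * sgn (u - x))"
    using near[of l] near[of u] l u by simp
  also have "\<dots> < 0" using l u free[of x] by (simp add: sgn_if)
  finally have "sgn (poly q l') * sgn (poly q u') < 0"
    using corr_sgn[OF \<rho> pcorr_poly[OF \<rho> pq(1) lu(1)]] corr_sgn[OF \<rho> pcorr_poly[OF \<rho> pq(1) lu(2)]] by simp
  then have "poly q l' * poly q u' < 0" by (simp flip: sgn_mult)
  moreover have "l' < u'" using corr_less_iff[OF \<rho> lu] l u by simp
  ultimately obtain y where y: "l' < y" "y < u'" "poly q y = 0" using poly_IVT by blast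
  have free': "poly (pderiv q) z \<noteq> 0" if "l' < z" "z < u'" for z
  proof
    assume z: "poly (pderiv q) z = 0"
    then obtain w where w: "(w, z) \<in> \<rho>" using crit(2) by blast
    then have "poly (pderiv p) w = 0" using corr_eq_0_iff[OF \<rho> pcorr_poly[OF \<rho> pq' w]] z by simp
    moreover have "l < w" "w < u" using corr_less_iff[OF \<rho> lu(1) w] corr_less_iff[OF \<rho> w lu(2)] that by simp_all
    ultimately show False using free by blast
  qed
  \<comment> \<open>Between \<open>l\<close> and \<open>u\<close> the position of \<open>a\<close>
    relative to \<open>x\<close> can be read off from the signs of \<open>p\<close> and its
    derivative at \<open>a\<close>; likewise for \<open>b\<close>, \<open>y\<close> and
    \<open>q\<close>. These signs correspond.\<close>
  have cut: "sgn (a - x) = sgn (b - y)" if ab: "(a, b) \<in> \<rho>" for a b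
  proof -
    consider "a \<le> l" | "l < a" "a < u" | "u \<le> a" by linarith
    then show ?thesis
    proof cases
      case 1
      then have "b \<le> l'" using corr_less_iff[OF \<rho> lu(1) ab] by simp
      then show ?thesis using 1 l y by simp
    next
      case 2
      then have b: "l' < b" "b < u'" using corr_less_iff[OF \<rho> lu(1) ab] corr_less_iff[OF \<rho> ab lu(2)] by simp_all
      have "sgn (poly (pderiv p) x) = sgn (poly (pderiv p) a)"
      proof (cases "a \<le> x")
        case True
        then show ?thesis using free 2 l u by (intro poly_sgn_eq[symmetric]) auto
      next
        case False
        then show ?thesis using free 2 l u by (intro poly_sgn_eq) auto
      qed
      moreover have "sgn (poly (pderiv q) y) = sgn (poly (pderiv q) b)"
      proof (cases "b \<le> y")
        case True
        then show ?thesis using free' b y by (intro poly_sgn_eq[symmetric]) auto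
      next
        case False
        then show ?thesis using free' b y by (intro poly_sgn_eq) auto
      qed
      moreover have "sgn (poly q b) = sgn (poly (pderiv q) y) * sgn (b - y)"
        using b by (intro poly_sgn_near_root[OF y(1,2,3) free']) simp_all
      moreover have "sgn (poly p a) = sgn (poly (pderiv p) x) * sgn (a - x)" using near[of a] 2 by simp
      moreover have "sgn (poly p a) = sgn (poly q b)" "sgn (poly (pderiv p) a) = sgn (poly (pderiv q) b)"
        by (intro corr_sgn[OF \<rho>] pcorr_poly \<rho> pq pq' ab)+
      moreover have "sgn (poly (pderiv q) b) \<noteq> 0" using free' b by (simp add: sgn_0_0)
      ultimately show ?thesis by simp
    next
      case 3
      then have "u' \<le> b" using corr_less_iff[OF \<rho> ab lu(2)] by simp
      then show ?thesis using 3 u y by simp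
    qed
  qed
  have "(x, y) \<in> \<rho>"
  proof (rule maximal_corr_adjoin[OF max])
    fix r s assume "pcorr \<rho> r s"
    then obtain r' s' where rs: "pcorr \<rho> r' s'" "degree r' < degree p" "poly r' x = poly r x" "poly s' y = poly s y"
      using pcorr_reduce[OF max pq deg x y(3)] by blast
    show "sgn (poly r x) = sgn (poly s y)"
    proof (cases "r' = 0")
      case True
      then have "s' = 0" using pcorr_eq_0_iff[OF \<rho> rs(1)] by simp
      then show ?thesis using True rs by simp
    next
      case False
      have "sgn (poly r' x) = sgn (poly s' y)"
        by (rule cut_sgn[OF max rs(1) False root_closedD[OF closed rs(1) False rs(2)] nx cut])
      then show ?thesis using rs by simp
    qed
  qed
  then show False using nx by blast
qed

lemma maximal_corr_root_closed:
  fixes \<rho> :: "('a \<times> 'a) set"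
  assumes max: "maximal_corr \<rho>"
  shows "root_closed d \<rho>"
proof (induction d)
  case 0
  then show ?case unfolding root_closed_def by simp
next
  case (Suc d)
  have \<rho>: "corr \<rho>" using max unfolding maximal_corr_def by simp
  have "x \<in> Domain \<rho>" if "pcorr \<rho> p q" "p \<noteq> 0" "degree p < Suc d" "poly p x = 0" for p q x
  proof (cases "degree p < d")
    case True
    then show ?thesis using root_closedD(1)[OF Suc] that by blast
  next
    case False
    then have "degree p = d" using that by simp
    then show ?thesis using root_closed_step[OF max _ that(1,2,4)] Suc by simp
  qed
  moreover have "y \<in> Range \<rho>" if pq: "pcorr \<rho> p q" "p \<noteq> 0" "degree p < Suc d" "poly q y = 0" for p q y
  proof (cases "degree p < d")
    case True
    then show ?thesis using root_closedD(2)[OF Suc] that by blast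
  next
    case False
    then have d: "degree q = d" using pq pcorr_degree[OF \<rho> pq(1)] by simp
    have "y \<in> Domain (\<rho>\<inverse>)"
    proof (rule root_closed_step[OF maximal_corr_converse[OF max] _ _ _ pq(4)])
      show "root_closed (degree q) (\<rho>\<inverse>)" unfolding d by (rule root_closed_converse[OF \<rho> Suc])
      show "pcorr (\<rho>\<inverse>) q p" using pq by (simp add: pcorr_converse)
      show "q \<noteq> 0" using pq pcorr_eq_0_iff[OF \<rho> pq(1)] by simp
    qed
    then show ?thesis by simp
  qed
  ultimately show ?case unfolding root_closed_def by blast
qed

text \<open>If \<open>x\<close> has no partner, the roots of the finitely many nonzero polynomials
  still lie in the domain, so a domain point can be sampled in the position of \<open>x\<close>. Its
  partner satisfies these finitely many conditions, although it need not realize the whole cut of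
  \<open>x\<close>.\<close>

lemma corr_extend_finite:
  fixes x :: 'a
  assumes max: "maximal_corr \<rho>" and F: "finite F" "\<And>p q. (p, q) \<in> F \<Longrightarrow> pcorr \<rho> p q"
  shows "\<exists>y. \<forall>(p, q)\<in>F. sgn (poly p x) = sgn (poly q y)"
proof (cases "x \<in> Domain \<rho>")
  case True
  have \<rho>: "corr \<rho>" using max unfolding maximal_corr_def by simp
  obtain y where "(x, y) \<in> \<rho>" using True by blast
  then show ?thesis using corr_sgn[OF \<rho> pcorr_poly[OF \<rho> F(2)]] by blast
next
  case False
  have \<rho>: "corr \<rho>" using max unfolding maximal_corr_def by simp
  define Z where "Z = (\<Union>p\<in>fst ` F - {0}. {z. poly p z = 0})"
  have "Z \<subseteq> Domain \<rho>"
  proof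
    fix z assume "z \<in> Z"
    then obtain p q where "(p, q) \<in> F" "p \<noteq> 0" "poly p z = 0" unfolding Z_def by fastforce
    then show "z \<in> Domain \<rho>"
      using root_closedD(1)[OF maximal_corr_root_closed[OF max, of "Suc (degree p)"] F(2)] by blast
  qed
  moreover have "finite Z" unfolding Z_def using F(1) by (auto simp: poly_roots_finite)
  moreover have "x \<notin> Z" using False \<open>Z \<subseteq> Domain \<rho>\<close> by blast
  ultimately obtain m where "m \<in> Domain \<rho>" and m: "\<And>z. z \<in> Z \<Longrightarrow> sgn (z - m) = sgn (z - x)"
    using maximal_corr_sample[OF max] by metis
  then obtain y where y: "(m, y) \<in> \<rho>" by blast
  have "sgn (poly p x) = sgn (poly q y)" if pq: "(p, q) \<in> F" for p q
  proof -
    have "sgn (poly p x) = sgn (poly p m)"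
    proof (cases "p = 0")
      case False
      then show ?thesis
        using pq by (intro poly_sgn_eq' m[symmetric]) (force simp: Z_def)
    qed simp
    also have "\<dots> = sgn (poly q y)" by (intro corr_sgn[OF \<rho>] pcorr_poly \<rho> F(2)[OF pq] y)
    finally show ?thesis .
  qed
  then show ?thesis by blast
qed

end

section \<open>Sign equivalence and elementary equivalence\<close>

definition qf_equiv :: "(nat \<Rightarrow> 'a::linordered_field) \<Rightarrow> (nat \<Rightarrow> 'a) \<Rightarrow> bool" where
  "qf_equiv e e' \<longleftrightarrow> (\<forall>t. sgn (tm_val e t) = sgn (tm_val e' t))"

lemma corr_tm_val:
  assumes "corr \<rho>" "\<And>j. (e j, e' j) \<in> \<rho>"
  shows "(tm_val e t, tm_val e' t) \<in> \<rho>"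
  using assms by (induction t) (auto intro: corrD)

lemma qf_equivI: "corr \<rho> \<Longrightarrow> (\<And>j. (e j, e' j) \<in> \<rho>) \<Longrightarrow> qf_equiv e e'"
  unfolding qf_equiv_def using corr_sgn corr_tm_val by blast

text \<open>The values of one term under both assignments form a pair, and all these pairs form a
  correspondence; it is then enlarged to a maximal one.\<close>

lemma qf_equivE:
  assumes "qf_equiv e e'"
  obtains \<rho> where "maximal_corr \<rho>" "\<And>j. (e j, e' j) \<in> \<rho>"
proof -
  define \<rho> where "\<rho> = {(tm_val e t, tm_val e' t) | t. True}"
  have I: "(tm_val e t, tm_val e' t) \<in> \<rho>" for t unfolding \<rho>_def by blast
  have "corr \<rho>"
  proof (rule corrI)
    show "(0, 0) \<in> \<rho>" "(1, 1) \<in> \<rho>" using I[of Zero] I[of One] by simp_all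
    fix a b assume "(a, b) \<in> \<rho>"
    then obtain t where t: "a = tm_val e t" "b = tm_val e' t" unfolding \<rho>_def by blast
    show "(- a, - b) \<in> \<rho>" using I[of "Minus t"] t by simp
    show "sgn a = sgn b" using assms t unfolding qf_equiv_def by simp
    fix c d assume "(c, d) \<in> \<rho>"
    then obtain s where s: "c = tm_val e s" "d = tm_val e' s" unfolding \<rho>_def by blast
    show "(a + c, b + d) \<in> \<rho>" using I[of "Add t s"] t s by simp
    show "(a * c, b * d) \<in> \<rho>" using I[of "Times t s"] t s by simp
  qed
  then obtain \<sigma> where "\<rho> \<subseteq> \<sigma>" "maximal_corr \<sigma>" using maximal_corr_exists by blast
  moreover have "(e j, e' j) \<in> \<rho>" for j using I[of "Var j"] by simp
  ultimately show thesis using that by blast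
qed

lemma tm_val_upd_poly:
  assumes "corr \<rho>" "\<And>j. (e j, e' j) \<in> \<rho>"
  shows "\<exists>p q. pcorr \<rho> p q \<and> (\<forall>x. tm_val (e(i := x)) t = poly p x) \<and> (\<forall>y. tm_val (e'(i := y)) t = poly q y)"
proof (induction t)
  case (Var j)
  show ?case
  proof (cases "j = i")
    case True
    then show ?thesis
      by (intro exI[of _ "[:0, 1:]"] conjI pcorr_X assms) simp_all
  next
    case False
    show ?thesis
      by (rule exI[of _ "[:e j:]"], rule exI[of _ "[:e' j:]"]) (simp add: False pcorr_const assms)
  qed
next
  case Zero
  show ?case by (intro exI[of _ 0] conjI pcorr_0 assms) simp_all
next
  case One
  show ?case by (intro exI[of _ "[:1:]"] conjI pcorr_const corrD(2) assms) simp_all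
next
  case (Add s t)
  then obtain p q r u where "pcorr \<rho> p q" "\<forall>x. tm_val (e(i := x)) s = poly p x" "\<forall>y. tm_val (e'(i := y)) s = poly q y"
    "pcorr \<rho> r u" "\<forall>x. tm_val (e(i := x)) t = poly r x" "\<forall>y. tm_val (e'(i := y)) t = poly u y" by metis
  then show ?case by - (rule exI[of _ "p + r"], rule exI[of _ "q + u"], (simp add: pcorr_add assms del: fun_upd_apply))
next
  case (Minus t)
  then obtain r u where
    "pcorr \<rho> r u" "\<forall>x. tm_val (e(i := x)) t = poly r x" "\<forall>y. tm_val (e'(i := y)) t = poly u y" by metis
  then show ?case by - (rule exI[of _ "- r"], rule exI[of _ "- u"], (simp add: pcorr_minus assms del: fun_upd_apply))
next
  case (Times s t)
  then obtain p q r u where "pcorr \<rho> p q" "\<forall>x. tm_val (e(i := x)) s = poly p x" "\<forall>y. tm_val (e'(i := y)) s = poly q y"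
    "pcorr \<rho> r u" "\<forall>x. tm_val (e(i := x)) t = poly r x" "\<forall>y. tm_val (e'(i := y)) t = poly u y" by metis
  then show ?case by - (rule exI[of _ "p * r"], rule exI[of _ "q * u"], (simp add: pcorr_mult assms del: fun_upd_apply))
qed

lemma countable_card_less:
  assumes "natLeq <o \<kappa>" "countable A"
  shows "|A| <o \<kappa>"
  using assms ordLeq_ordLess_trans unfolding countable_card_le_natLeq by blast

text \<open>The parameter \<open>e j\<close> is stored at index \<open>j + 1\<close>, since types are in the variable \<open>0\<close>.\<close>
primrec shift_tm :: "nat \<Rightarrow> tm \<Rightarrow> tm" where
  "shift_tm i (Var j) = Var (if j = i then 0 else Suc j)"
| "shift_tm i Zero = Zero"
| "shift_tm i One = One"
| "shift_tm i (Add s t) = Add (shift_tm i s) (shift_tm i t)"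
| "shift_tm i (Minus t) = Minus (shift_tm i t)"
| "shift_tm i (Times s t) = Times (shift_tm i s) (shift_tm i t)"

lemma tm_val_shift_tm: "tm_val (case_nat x e) (shift_tm i t) = tm_val (e(i := x)) t"
  by (induction t) auto

definition sgn_fm :: "'a::linordered_field \<Rightarrow> tm \<Rightarrow> fm" where
  "sgn_fm a t = (if a = 0 then Equal t Zero else if a > 0 then Less Zero t else Less t Zero)"

lemma sat_sgn_fm: "sat e (sgn_fm a t) \<longleftrightarrow> sgn a = sgn (tm_val e t)"
  unfolding sgn_fm_def by (auto simp: sgn_if)

context poly_IVT_field
begin

text \<open>The extension step of the back-and-forth: the signs of all terms at \<open>x\<close>
  form a finitely satisfiable type over the countable range of \<open>e'\<close>, and saturation
  realizes it.\<close>

lemma qf_equiv_extend: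
  fixes e e' :: "nat \<Rightarrow> 'a"
  assumes sat: "saturated \<kappa> TYPE('a)" "natLeq <o \<kappa>" and eq: "qf_equiv e e'"
  shows "\<exists>y. qf_equiv (e(i := x)) (e'(i := y))"
proof -
  \<comment> \<open>The value 0 in slot \<open>0\<close> is a placeholder, overwritten by the
    element that realizes the type.\<close>
  define c where "c = case_nat 0 e'"
  define \<Phi> where "\<Phi> t = (sgn_fm (tm_val (e(i := x)) t) (shift_tm i t), c)" for t
  have c: "c(0 := y) = case_nat y e'" for y by (auto simp: c_def fun_eq_iff split: nat.split)
  have real: "realizes y (\<Phi> ` T) \<longleftrightarrow> (\<forall>t\<in>T. sgn (tm_val (e(i := x)) t) = sgn (tm_val (e'(i := y)) t))" for y T
    unfolding realizes_def \<Phi>_def by (simp add: sat_sgn_fm c tm_val_shift_tm)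
  obtain \<rho> where \<rho>: "maximal_corr \<rho>" "\<And>j. (e j, e' j) \<in> \<rho>" using qf_equivE[OF eq] by blast
  then have corr: "corr \<rho>" unfolding maximal_corr_def by simp
  have fin: "\<exists>y. realizes y (\<Phi> ` T)" if T: "finite T" for T
  proof -
    have "\<exists>pq. pcorr \<rho> (fst pq) (snd pq) \<and> (\<forall>x. tm_val (e(i := x)) t = poly (fst pq) x) \<and>
      (\<forall>y. tm_val (e'(i := y)) t = poly (snd pq) y)" for t
      using tm_val_upd_poly[OF corr \<rho>(2), where i = i and t = t] by (simp only: split_paired_Ex fst_conv snd_conv)
    then obtain pq where pq: "\<And>t. pcorr \<rho> (fst (pq t)) (snd (pq t))"
      "\<And>t x. tm_val (e(i := x)) t = poly (fst (pq t)) x" "\<And>t y. tm_val (e'(i := y)) t = poly (snd (pq t)) y"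
      using choice[of "\<lambda>t pq. pcorr \<rho> (fst pq) (snd pq) \<and> (\<forall>x. tm_val (e(i := x)) t = poly (fst pq) x) \<and>
        (\<forall>y. tm_val (e'(i := y)) t = poly (snd pq) y)"] by blast
    have "\<exists>y. \<forall>(p, q)\<in>pq ` T. sgn (poly p x) = sgn (poly q y)"
      by (rule corr_extend_finite[OF \<rho>(1)]) (use T pq(1) in \<open>simp, metis fst_conv snd_conv imageE\<close>)
    then show ?thesis unfolding real pq(2,3) by (simp add: case_prod_beta)
  qed
  have "|range c| <o \<kappa>" by (rule countable_card_less[OF sat(2)]) simp
  moreover have "range \<Phi> \<subseteq> formulas_over (range c)" unfolding formulas_over_def \<Phi>_def by auto
  moreover have "\<exists>y. realizes y q" if "q \<subseteq> range \<Phi>" "finite q" for q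
    using finite_subset_image[OF that(2,1)] fin by blast
  ultimately have "\<exists>y. realizes y (range \<Phi>)"
    using sat(1) unfolding saturated_def by blast
  then show ?thesis unfolding real qf_equiv_def by simp
qed

text \<open>Atomic formulas are decided by the sign of a difference. For a quantifier a witness is
  moved to the other side by the extension step, in either direction since \<open>qf_equiv\<close>
  is symmetric.\<close>

lemma qf_equiv_sat:
  fixes e e' :: "nat \<Rightarrow> 'a"
  assumes sat: "saturated \<kappa> TYPE('a)" "natLeq <o \<kappa>" and eq: "qf_equiv e e'"
  shows "sat e \<phi> \<longleftrightarrow> sat e' \<phi>"
  using eq
proof (induction \<phi> arbitrary: e e')
  case (Equal s t)
  then have "sgn (tm_val e (Add s (Minus t))) = sgn (tm_val e' (Add s (Minus t)))"
    unfolding qf_equiv_def by blast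
  then show ?case by (auto simp: sgn_if split: if_splits)
next
  case (Less s t)
  then have "sgn (tm_val e (Add s (Minus t))) = sgn (tm_val e' (Add s (Minus t)))"
    unfolding qf_equiv_def by blast
  then show ?case by (auto simp: sgn_if split: if_splits)
next
  case (Neg \<phi>)
  then show ?case by simp
next
  case (Conj \<phi> \<psi>)
  then show ?case by simp
next
  case (Exists i \<phi>)
  have "qf_equiv e' e" using Exists.prems unfolding qf_equiv_def by simp
  then show ?case
    using qf_equiv_extend[OF sat] Exists by (metis sat.simps(5))
qed

end

section \<open>Infinitesimals\<close>

text \<open>For positive \<open>a\<close> this says that \<open>u\<close> is below
  \<open>b / a\<close>. It is stated without division because \<open>B\<close> will be a ring and
  not a field.\<close>

definition infinitesimal_over :: "'a::linordered_field set \<Rightarrow> 'a \<Rightarrow> bool" where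
  "infinitesimal_over B u \<longleftrightarrow> 0 < u \<and> (\<forall>a\<in>B. \<forall>b\<in>B. 0 < b \<longrightarrow> u * a < b)"

lemma infinitesimal_over_subset: "infinitesimal_over B u \<Longrightarrow> A \<subseteq> B \<Longrightarrow> infinitesimal_over A u"
  unfolding infinitesimal_over_def by blast

lemma subring_set_poly: "subring_set B \<Longrightarrow> (\<And>i. coeff p i \<in> B) \<Longrightarrow> z \<in> B \<Longrightarrow> poly p z \<in> B"
  unfolding poly_altdef by (intro subring_set_intros)

text \<open>The sum of the absolute values of the coefficients is a bound. It lies in
  \<open>B\<close> and can therefore be compared with an infinitesimal over
  \<open>B\<close>.\<close>

lemma poly_bounded_unit_interval:
  fixes p :: "'a::linordered_field poly"
  assumes B: "subring_set B" and p: "\<And>i. coeff p i \<in> B"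
  shows "\<exists>M\<in>B. 0 \<le> M \<and> (\<forall>u. 0 < u \<and> u < 1 \<longrightarrow> \<bar>poly p u\<bar> \<le> M)"
  using p
proof (induction p)
  case 0
  show ?case using subring_setD(1)[OF B] by (intro bexI[of _ 0]) simp_all
next
  case (pCons c p)
  have "coeff p i \<in> B" for i using pCons.prems[of "Suc i"] by simp
  then obtain M where M: "M \<in> B" "0 \<le> M" "\<And>u. 0 < u \<Longrightarrow> u < 1 \<Longrightarrow> \<bar>poly p u\<bar> \<le> M"
    using pCons.IH by blast
  have c: "c \<in> B" using pCons.prems[of 0] by simp
  then have "\<bar>c\<bar> + M \<in> B" using subring_setD[OF B] M by (simp add: abs_if)
  moreover have "\<bar>poly (pCons c p) u\<bar> \<le> \<bar>c\<bar> + M" if u: "0 < u" "u < 1" for u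
  proof -
    have "\<bar>u * poly p u\<bar> \<le> 1 * M"
      unfolding abs_mult using u M by (intro mult_mono) auto
    then show ?thesis using abs_triangle_ineq[of c "u * poly p u"] by simp
  qed
  ultimately show ?case using M by (intro bexI[of _ "\<bar>c\<bar> + M"]) auto
qed

text \<open>The constant term dominates: the other terms are at most \<open>u * M\<close> for a
  bound \<open>M\<close> in \<open>B\<close>, hence smaller than the nonzero constant term.\<close>

lemma sgn_poly_infinitesimal:
  fixes p :: "'a::linordered_field poly"
  assumes B: "subring_set B" and p: "\<And>i. coeff p i \<in> B" and u: "infinitesimal_over B u"
    and nz: "coeff p 0 \<noteq> 0"
  shows "sgn (poly p u) = sgn (coeff p 0)"
proof -
  obtain c q where cq: "p = pCons c q" by (cases p)
  then have q: "coeff q i \<in> B" for i using p[of "Suc i"] by simp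
  have c: "c \<in> B" "c \<noteq> 0" using p[of 0] nz cq by simp_all
  have u0: "0 < u" using u unfolding infinitesimal_over_def by blast
  have "u * 1 < 1" using u subring_setD(2)[OF B] unfolding infinitesimal_over_def by force
  then have u1: "u < 1" by simp
  obtain M where M: "M \<in> B" "\<bar>poly q u\<bar> \<le> M"
    using poly_bounded_unit_interval[OF B q] u0 u1 by blast
  have "\<bar>c\<bar> \<in> B" using c subring_setD(3)[OF B] by (simp add: abs_if)
  then have "u * M < \<bar>c\<bar>" using u M c unfolding infinitesimal_over_def by simp
  moreover have "\<bar>u * poly q u\<bar> \<le> u * M" using M u0 by (simp add: abs_mult)
  ultimately have "\<bar>u * poly q u\<bar> < \<bar>c\<bar>" by simp
  then have "sgn (c + u * poly q u) = sgn c" by (auto simp: sgn_if abs_if split: if_splits)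
  then show ?thesis by (simp add: cq)
qed

lemma subring_set_Domain: "corr \<rho> \<Longrightarrow> subring_set (Domain \<rho>)"
  unfolding subring_set_def using corrD[of \<rho>] by (simp add: Domain_iff) blast

lemma subring_set_Range: "corr \<rho> \<Longrightarrow> subring_set (Range \<rho>)"
  using subring_set_Domain[OF corr_converse] by simp

text \<open>Vanishing constant terms are split off together with a positive factor \<open>u\<close>
  or \<open>u'\<close>; the first nonzero coefficient then decides. So any two positive
  infinitesimals may be paired.\<close>

lemma sgn_poly_corr_infinitesimal:
  assumes \<rho>: "corr \<rho>" and u: "infinitesimal_over (Domain \<rho>) u" "infinitesimal_over (Range \<rho>) u'"
    and "pcorr \<rho> p q"
  shows "sgn (poly p u) = sgn (poly q u')"
  using assms(4)
proof (induction p arbitrary: q)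
  case 0
  then have "q = 0" using pcorr_eq_0_iff[OF \<rho>] by blast
  then show ?case by simp
next
  case (pCons a p)
  obtain b r where q: "q = pCons b r" by (cases q)
  have ab: "(a, b) \<in> \<rho>" using pcorr_coeff[OF pCons.prems, of 0] by (simp add: q)
  have pr: "pcorr \<rho> p r"
    unfolding pcorr_def
  proof
    fix i show "(coeff p i, coeff r i) \<in> \<rho>" using pcorr_coeff[OF pCons.prems, of "Suc i"] by (simp add: q)
  qed
  show ?case
  proof (cases "a = 0")
    case True
    then have "b = 0" using corr_eq_0_iff[OF \<rho> ab] by simp
    moreover have "u > 0" "u' > 0" using u unfolding infinitesimal_over_def by simp_all
    ultimately show ?thesis using True pCons.IH[OF pr] by (simp add: q sgn_mult)
  next
    case False
    then have "b \<noteq> 0" using corr_eq_0_iff[OF \<rho> ab] by simp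
    have "sgn (poly (pCons a p) u) = sgn a"
      using sgn_poly_infinitesimal[OF subring_set_Domain[OF \<rho>] _ u(1), of "pCons a p"] False pcorr_coeff[OF pCons.prems]
      by (force simp: Domain_iff)
    also have "\<dots> = sgn b" by (rule corr_sgn[OF \<rho> ab])
    also have "\<dots> = sgn (poly q u')"
      using sgn_poly_infinitesimal[OF subring_set_Range[OF \<rho>] _ u(2), of q] \<open>b \<noteq> 0\<close> pcorr_coeff[OF pCons.prems]
      by (force simp: q)
    finally show ?thesis .
  qed
qed

lemma small_positive_exists:
  assumes "finite T" "\<And>a b. (a, b) \<in> T \<Longrightarrow> 0 < (b :: 'a::linordered_field)"
  shows "\<exists>u>0. \<forall>(a, b)\<in>T. u * a < b"
  using assms
proof (induction T)
  case empty
  show ?case by (intro exI[of _ 1]) simp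
next
  case (insert ab T)
  obtain u where u: "u > 0" "\<And>a b. (a, b) \<in> T \<Longrightarrow> u * a < b" using insert by fastforce
  obtain a b where ab: "ab = (a, b)" by (cases ab)
  have b: "b > 0" using insert.prems[of a b] ab by simp
  \<comment> \<open>The added 1 avoids a zero denominator and makes the inequality strict.\<close>
  define w where "w = min u (b / (1 + \<bar>a\<bar>))"
  have den: "1 + \<bar>a\<bar> > 0" by (simp add: add_pos_nonneg)
  have w: "w > 0" using u b den by (simp add: w_def)
  have "w * a < b"
  proof -
    have "w * a \<le> w * \<bar>a\<bar>" using w by (intro mult_left_mono) auto
    also have "\<dots> < w * (1 + \<bar>a\<bar>)" using w by simp
    also have "\<dots> \<le> b / (1 + \<bar>a\<bar>) * (1 + \<bar>a\<bar>)" using den by (intro mult_right_mono) (auto simp: w_def)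
    also have "\<dots> = b" using den by simp
    finally show ?thesis .
  qed
  moreover have "w * a' < b'" if "(a', b') \<in> T" for a' b'
  proof (cases "0 \<le> a'")
    case True
    then have "w * a' \<le> u * a'" by (intro mult_right_mono) (simp_all add: w_def)
    then show ?thesis using u(2)[OF that] by simp
  next
    case False
    then have "w * a' < 0" using w by (simp add: mult_pos_neg)
    also have "0 < b'" using insert.prems that by blast
    finally show ?thesis .
  qed
  ultimately show ?case using w ab by (intro exI[of _ w]) auto
qed

lemma infinitesimal_exists:
  fixes B :: "'c::linordered_field set"
  assumes sat: "saturated \<kappa> TYPE('c)" and "natLeq <o \<kappa>" "countable B" and B: "subring_set B"
  shows "\<exists>u. infinitesimal_over B u"
proof -
  define \<Phi> :: "'c \<times> 'c \<Rightarrow> fm \<times> (nat \<Rightarrow> 'c)" where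
    "\<Phi> ab = (Conj (Less Zero (Var 0)) (Less (Times (Var 0) (Var 1)) (Var 2)),
      \<lambda>i. if i = 1 then fst ab else snd ab)" for ab
  define P where "P = {(a, b). a \<in> B \<and> b \<in> B \<and> 0 < b}"
  have real: "realizes u (\<Phi> ` T) \<longleftrightarrow> (\<forall>(a, b)\<in>T. 0 < u \<and> u * a < b)" for u T
    unfolding realizes_def \<Phi>_def by (auto simp: case_prod_beta)
  have "\<exists>u. realizes u q" if q: "q \<subseteq> \<Phi> ` P" "finite q" for q
  proof -
    obtain T where T: "T \<subseteq> P" "finite T" "q = \<Phi> ` T" using finite_subset_image[OF q(2,1)] by blast
    then obtain u where "u > 0" "\<forall>(a, b)\<in>T. u * a < b" using small_positive_exists[of T] unfolding P_def by blast
    then show ?thesis unfolding T real by blast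
  qed
  moreover have "\<Phi> ` P \<subseteq> formulas_over B"
    unfolding formulas_over_def \<Phi>_def P_def by auto
  moreover have "|B| <o \<kappa>" by (rule countable_card_less) fact+
  ultimately obtain u where "realizes u (\<Phi> ` P)"
    using sat[unfolded saturated_def, rule_format, of B "\<Phi> ` P"] by blast
  then have *: "\<forall>(a, b)\<in>P. 0 < u \<and> u * a < b" unfolding real .
  \<comment> \<open>Positivity of \<open>u\<close> is part of every formula of the type, so a single
    pair in \<open>P\<close> yields it.\<close>
  have "(0, 1) \<in> P" using subring_setD(1,2)[OF B] unfolding P_def by simp
  then have "u > 0" using * by blast
  then show ?thesis using * unfolding P_def infinitesimal_over_def by blast
qed

section \<open>Chains of rings with successive infinitesimals\<close>

definition ring_hull :: "'a::linordered_field set \<Rightarrow> 'a set" where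
  "ring_hull A = range (tm_val (from_nat_into A))"

instance tm :: countable by countable_datatype

text \<open>There are only countably many terms; this keeps all parameter sets of the chain small
  for saturation.\<close>

lemma countable_ring_hull: "countable (ring_hull A)"
  unfolding ring_hull_def by simp

lemma subring_set_range_tm_val: "subring_set (range (tm_val e))"
  unfolding subring_set_def
proof (intro conjI ballI)
  show "0 \<in> range (tm_val e)" "1 \<in> range (tm_val e)" using rangeI[of "tm_val e" Zero] rangeI[of "tm_val e" One] by simp_all
  fix a assume "a \<in> range (tm_val e)"
  then obtain s where s: "a = tm_val e s" by blast
  show "- a \<in> range (tm_val e)" using rangeI[of "tm_val e" "Minus s"] s by simp
  fix b assume "b \<in> range (tm_val e)"
  then obtain t where t: "b = tm_val e t" by blast
  show "a + b \<in> range (tm_val e)" "a * b \<in> range (tm_val e)"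
    using rangeI[of "tm_val e" "Add s t"] rangeI[of "tm_val e" "Times s t"] s t by simp_all
qed

lemma subring_set_tm_val: "subring_set B \<Longrightarrow> (\<And>j. e j \<in> B) \<Longrightarrow> tm_val e t \<in> B"
  by (induction t) (simp_all add: subring_setD)

lemma subset_ring_hull: "countable A \<Longrightarrow> A \<subseteq> ring_hull A"
proof
  fix a assume "countable A" "a \<in> A"
  then obtain n where "a = from_nat_into A n" by (metis from_nat_into_surj)
  then show "a \<in> ring_hull A" unfolding ring_hull_def using rangeI[of "tm_val (from_nat_into A)" "Var n"] by simp
qed

text \<open>The rings only have to increase and need not be generated by what precedes them. This
  permits \<open>V 0\<close> to be exchanged for another ring later.\<close>

definition infinitesimal_chain :: "(nat \<Rightarrow> 'a::linordered_field set) \<Rightarrow> (nat \<Rightarrow> 'a) \<Rightarrow> bool" where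
  "infinitesimal_chain V d \<longleftrightarrow> (\<forall>n. subring_set (V n) \<and> V n \<subseteq> V (Suc n) \<and> d n \<in> V (Suc n) \<and> infinitesimal_over (V n) (d n))"

lemma infinitesimal_chain_exists:
  fixes A :: "'c::linordered_field set"
  assumes sat: "saturated \<kappa> TYPE('c)" "natLeq <o \<kappa>" and A: "countable A"
  shows "\<exists>R d. A \<subseteq> R 0 \<and> infinitesimal_chain R d"
proof -
  define \<epsilon> where "\<epsilon> B = (SOME u. infinitesimal_over B u)" for B :: "'c set"
  define F where "F B = ring_hull (insert (\<epsilon> B) B)" for B
  define R where "R n = (F ^^ n) (ring_hull A)" for n
  have R: "subring_set (R n) \<and> countable (R n)" for n
    unfolding R_def F_def by (cases n) (simp_all add: countable_ring_hull, simp_all add: ring_hull_def subring_set_range_tm_val)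
  have Suc: "R (Suc n) = ring_hull (insert (\<epsilon> (R n)) (R n))" for n by (simp add: R_def F_def)
  have "insert (\<epsilon> (R n)) (R n) \<subseteq> R (Suc n)" for n unfolding Suc using R by (intro subset_ring_hull) simp
  moreover have "infinitesimal_over (R n) (\<epsilon> (R n))" for n
    unfolding \<epsilon>_def using infinitesimal_exists[OF sat] R by (metis someI_ex)
  moreover have "A \<subseteq> R 0" unfolding R_def using subset_ring_hull[OF A] by simp
  ultimately show ?thesis using R unfolding infinitesimal_chain_def
    by (intro exI[of _ R] exI[of _ "\<lambda>n. \<epsilon> (R n)"]) auto
qed

lemma infinitesimal_chain_mono:
  assumes "infinitesimal_chain V d" "m \<le> n"
  shows "V m \<subseteq> V n"
  by (rule lift_Suc_mono_le[OF _ assms(2)]) (use assms(1) in \<open>simp add: infinitesimal_chain_def\<close>)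

lemma infinitesimal_chain_decreasing:
  assumes V: "infinitesimal_chain V d" and "m < n"
  shows "d n < d m"
proof -
  have "d m \<in> V (Suc m)" "0 < d m" "1 \<in> V n" "infinitesimal_over (V n) (d n)"
    using V subring_setD(2) unfolding infinitesimal_chain_def infinitesimal_over_def by blast+
  moreover have "V (Suc m) \<subseteq> V n" using infinitesimal_chain_mono[OF V] assms(2) by simp
  ultimately have "d n * 1 < d m" unfolding infinitesimal_over_def by blast
  then show ?thesis by simp
qed

text \<open>Starting from the identity on \<open>V 0\<close>, the pairs are adjoined one at a time.
  The bounds on domain and range are carried along because they make the next \<open>d (s n)\<close>
  and \<open>d (t n)\<close> infinitesimal over what has been adjoined so far.\<close>

lemma infinitesimal_chain_corr:
  fixes n :: nat
  assumes V: "infinitesimal_chain V d" and v: "v \<in> V 0"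
    and st: "\<And>i j. i < j \<Longrightarrow> j < n \<Longrightarrow> s i < s j \<and> t i < t j"
  shows "\<exists>\<rho>. corr \<rho> \<and> (v, v) \<in> \<rho> \<and> (\<forall>i<n. (d (s i), d (t i)) \<in> \<rho>) \<and>
    (\<forall>m. (\<forall>i<n. s i < m) \<longrightarrow> Domain \<rho> \<subseteq> V m) \<and> (\<forall>m. (\<forall>i<n. t i < m) \<longrightarrow> Range \<rho> \<subseteq> V m)"
  using st
proof (induction n)
  case 0
  have V0: "subring_set (V 0)" using V unfolding infinitesimal_chain_def by blast
  define \<rho> where "\<rho> = {(a, a) | a. a \<in> V 0}"
  have "corr \<rho>" by (rule corrI) (auto simp: \<rho>_def subring_setD[OF V0])
  moreover have "Domain \<rho> \<subseteq> V m" "Range \<rho> \<subseteq> V m" for m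
    using infinitesimal_chain_mono[OF V, of 0 m] by (auto simp: \<rho>_def)
  moreover have "(v, v) \<in> \<rho>" using v by (simp add: \<rho>_def)
  ultimately show ?case by blast
next
  case (Suc n)
  then obtain \<rho> where \<rho>: "corr \<rho>" "(v, v) \<in> \<rho>" "\<And>i. i < n \<Longrightarrow> (d (s i), d (t i)) \<in> \<rho>"
    and dom: "\<And>m. (\<And>i. i < n \<Longrightarrow> s i < m) \<Longrightarrow> Domain \<rho> \<subseteq> V m"
    and ran: "\<And>m. (\<And>i. i < n \<Longrightarrow> t i < m) \<Longrightarrow> Range \<rho> \<subseteq> V m"
    by (metis less_SucI)
  have lt: "s i < s n" "t i < t n" if "i < n" for i using Suc.prems[of i n] that by auto
  have V': "subring_set (V k)" "d k \<in> V (Suc k)" "infinitesimal_over (V k) (d k)" for k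
    using V unfolding infinitesimal_chain_def by blast+
  have inf: "infinitesimal_over (Domain \<rho>) (d (s n))" "infinitesimal_over (Range \<rho>) (d (t n))"
    using infinitesimal_over_subset[OF V'(3) dom] infinitesimal_over_subset[OF V'(3) ran] lt by blast+
  note adj = corr_adjoin[OF \<rho>(1) sgn_poly_corr_infinitesimal[OF \<rho>(1) inf]]
  let ?\<sigma> = "adjoin \<rho> (d (s n)) (d (t n))"
  have "(d (s i), d (t i)) \<in> ?\<sigma>" if "i < Suc n" for i
    using that adj(2,3) \<rho>(3)[of i] by (cases "i = n") auto
  moreover have "Domain ?\<sigma> \<subseteq> V m" if m: "\<forall>i<Suc n. s i < m" for m
  proof
    fix z assume "z \<in> Domain ?\<sigma>"
    then obtain p q where pq: "pcorr \<rho> p q" "z = poly p (d (s n))" unfolding adjoin_def by blast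
    have "d (s n) \<in> V m" using V'(2)[of "s n"] infinitesimal_chain_mono[OF V, of "Suc (s n)" m] m[rule_format, of n] by auto
    moreover have "coeff p i \<in> V m" for i using pcorr_coeff[OF pq(1), of i] dom[of m] m by auto
    ultimately show "z \<in> V m" unfolding pq(2) by (intro subring_set_poly V'(1))
  qed
  moreover have "Range ?\<sigma> \<subseteq> V m" if m: "\<forall>i<Suc n. t i < m" for m
  proof
    fix z assume "z \<in> Range ?\<sigma>"
    then obtain p q where pq: "pcorr \<rho> p q" "z = poly q (d (t n))" unfolding adjoin_def by blast
    have "d (t n) \<in> V m" using V'(2)[of "t n"] infinitesimal_chain_mono[OF V, of "Suc (t n)" m] m[rule_format, of n] by auto
    moreover have "coeff q i \<in> V m" for i using pcorr_coeff[OF pq(1), of i] ran[of m] m by auto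
    ultimately show "z \<in> V m" unfolding pq(2) by (intro subring_set_poly V'(1))
  qed
  ultimately show ?case using adj(1,2) \<rho>(2) by blast
qed

text \<open>A term with all variables equal to \<open>x\<close> is an integer polynomial in
  \<open>x\<close>, so this is transcendence over the rationals, formulated by terms.\<close>

definition transcendental :: "'a::linordered_field \<Rightarrow> bool" where
  "transcendental x \<longleftrightarrow> (\<forall>t. tm_val (\<lambda>_. x) t = 0 \<longrightarrow> (\<forall>z :: 'a. tm_val (\<lambda>_. z) t = 0))"

lemma tm_val_poly_env:
  assumes "subring_set B" "\<And>i. coeff p i \<in> B"
  shows "\<exists>q. (\<forall>i. coeff q i \<in> B) \<and> (\<forall>z. tm_val (\<lambda>_. poly p z) t = poly q z)"
proof (induction t)
  case (Var j)
  show ?case using assms(2) by auto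
next
  case Zero
  show ?case using subring_setD[OF assms(1)] by (intro exI[of _ 0]) simp
next
  case One
  show ?case using subring_setD[OF assms(1)] by (intro exI[of _ 1]) (simp add: coeff_1)
next
  case (Add s t)
  then obtain q r where "\<forall>i. coeff q i \<in> B" "\<forall>z. tm_val (\<lambda>_. poly p z) s = poly q z"
    "\<forall>i. coeff r i \<in> B" "\<forall>z. tm_val (\<lambda>_. poly p z) t = poly r z" by blast
  then show ?case using subring_setD[OF assms(1)] by - (rule exI[of _ "q + r"], simp)
next
  case (Minus t)
  then obtain r where
    "\<forall>i. coeff r i \<in> B" "\<forall>z. tm_val (\<lambda>_. poly p z) t = poly r z" by blast
  then show ?case using subring_setD[OF assms(1)] by - (rule exI[of _ "- r"], simp)
next
  case (Times s t)
  then obtain q r where "\<forall>i. coeff q i \<in> B" "\<forall>z. tm_val (\<lambda>_. poly p z) s = poly q z"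
    "\<forall>i. coeff r i \<in> B" "\<forall>z. tm_val (\<lambda>_. poly p z) t = poly r z" by blast
  then show ?case
    by - (rule exI[of _ "q * r"], auto simp: coeff_mult intro!: subring_set_intros assms(1))
qed

text \<open>
  In \<open>z - d\<^sub>0 + d\<^sub>n\<close> the element \<open>z\<close> occurs for \<open>n = 0\<close>. As \<open>z\<close> is transcendental, \<open>z - d\<^sub>0\<close> behaves like
  \<open>z\<close>: a polynomial nonzero at \<open>z - d\<^sub>0\<close> has a nonzero constant term when expanded in powers of \<open>d\<^sub>0\<close>.
\<close>
lemma infinitesimal_chain_shift:
  assumes R: "infinitesimal_chain R d" and z: "z \<in> R 0" "transcendental z"
  defines "v \<equiv> z - d 0"
  shows "infinitesimal_chain (\<lambda>n. if n = 0 then range (tm_val (\<lambda>_. v)) else R n) d"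
proof -
  have R': "subring_set (R k)" "R k \<subseteq> R (Suc k)" "d k \<in> R (Suc k)" "infinitesimal_over (R k) (d k)" for k
    using R unfolding infinitesimal_chain_def by blast+
  have "v \<in> R 1" unfolding v_def using R'(2,3)[of 0] z(1) subring_setD(6)[OF R'(1)] by auto
  then have sub: "range (tm_val (\<lambda>_. v)) \<subseteq> R 1" by (auto intro: subring_set_tm_val[OF R'(1)])
  have shift: "\<exists>q. (\<forall>i. coeff q i \<in> R 0) \<and> coeff q 0 = tm_val (\<lambda>_. z) t \<and> tm_val (\<lambda>_. v) t = poly q (d 0)" for t
  proof -
    have "coeff [:z, -1:] i \<in> R 0" for i
      using z(1) subring_setD[OF R'(1)[of 0]] by (simp add: coeff_pCons split: nat.split)
    from tm_val_poly_env[OF R'(1) this, of t] obtain q where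
      q: "\<forall>i. coeff q i \<in> R 0" "\<And>w. tm_val (\<lambda>_. z - w) t = poly q w" by auto
    from q(2)[of 0] q(2)[of "d 0"] have "coeff q 0 = tm_val (\<lambda>_. z) t" "tm_val (\<lambda>_. v) t = poly q (d 0)"
      by (simp_all add: v_def poly_0_coeff_0)
    then show ?thesis using q by blast
  qed
  have "infinitesimal_over (range (tm_val (\<lambda>_. v))) (d 0)"
    unfolding infinitesimal_over_def
  proof (intro conjI ballI impI)
    show "0 < d 0" using R'(4) unfolding infinitesimal_over_def by blast
    fix a b assume "a \<in> range (tm_val (\<lambda>_. v))" "b \<in> range (tm_val (\<lambda>_. v))" and "0 < b"
    then obtain s t where s: "a = tm_val (\<lambda>_. v) s" and t: "b = tm_val (\<lambda>_. v) t" by blast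
    obtain p where p: "\<forall>i. coeff p i \<in> R 0" "a = poly p (d 0)" using shift[of s] s by blast
    obtain q where q: "\<forall>i. coeff q i \<in> R 0" "coeff q 0 = tm_val (\<lambda>_. z) t" "b = poly q (d 0)" using shift[of t] t by blast
    have nz: "coeff q 0 \<noteq> 0" using z(2) \<open>0 < b\<close> t q(2) unfolding transcendental_def by force
    have "sgn b = sgn (coeff q 0)"
      unfolding q(3) using q nz by (intro sgn_poly_infinitesimal[OF R'(1) _ R'(4)]) auto
    \<comment> \<open>Subtracting \<open>d 0 * a\<close> changes \<open>q\<close> only above its
      constant coefficient, so the sign of \<open>b\<close> is kept.\<close>
    moreover have "sgn (poly (q - pCons 0 p) (d 0)) = sgn (coeff (q - pCons 0 p) 0)"
      using q p nz subring_setD[OF R'(1)[of 0]]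
      by (intro sgn_poly_infinitesimal[OF R'(1) _ R'(4)]) (auto simp: coeff_pCons split: nat.split)
    ultimately have "sgn (b - d 0 * a) = sgn b" by (simp add: p q)
    then show "d 0 * a < b" using \<open>0 < b\<close> by (simp add: sgn_if split: if_splits)
  qed
  then show ?thesis
    using R' sub subring_set_range_tm_val unfolding infinitesimal_chain_def by auto
qed

section \<open>Sequences of translates and perpendicularity\<close>

text \<open>Neighbors are indexed by subsets of the type \<open>'k\<close>; the injection
  \<open>g\<close> carries the order of the natural numbers there, independently of any order on
  that type.\<close>

definition nat_sequence :: "(nat \<Rightarrow> 'i) \<Rightarrow> (nat \<Rightarrow> 'c) \<Rightarrow> ('i, 'c) sequence" where
  "nat_sequence g f = \<lparr>ord = {(g m, g n) | m n. m \<le> n}, val = f \<circ> the_inv g\<rparr>"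

context
  fixes g :: "nat \<Rightarrow> 'i"
  assumes g: "inj g"
begin

lemma ord_nat_sequence: "(g m, g n) \<in> ord (nat_sequence g f) \<longleftrightarrow> m \<le> n"
  unfolding nat_sequence_def using injD[OF g] by auto

lemma idx_nat_sequence: "idx (nat_sequence g f) = range g"
  unfolding idx_def nat_sequence_def Field_def by auto

lemma val_nat_sequence: "val (nat_sequence g f) (g n) = f n"
  unfolding nat_sequence_def using the_inv_f_f[OF g] by simp

lemma elems_nat_sequence: "elems (nat_sequence g f) = range f"
  unfolding elems_def idx_nat_sequence by (simp add: image_image val_nat_sequence)

lemma Linear_order_nat_sequence: "Linear_order (ord (nat_sequence g f))"
proof -
  let ?r = "ord (nat_sequence g f)"
  have F: "Field ?r = range g" using idx_nat_sequence[of f] unfolding idx_def .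
  have sub: "?r \<subseteq> range g \<times> range g" unfolding nat_sequence_def by auto
  have "refl_on (range g) ?r" by (rule refl_onI) (auto simp: ord_nat_sequence)
  moreover have "trans ?r"
  proof (rule transI)
    fix x y z assume "(x, y) \<in> ?r" "(y, z) \<in> ?r"
    then obtain k m n where "x = g k" "y = g m" "z = g n" using sub by blast
    with \<open>(x, y) \<in> ?r\<close> \<open>(y, z) \<in> ?r\<close> show "(x, z) \<in> ?r" by (simp add: ord_nat_sequence)
  qed
  moreover have "antisym ?r"
  proof (rule antisymI)
    fix x y assume "(x, y) \<in> ?r" "(y, x) \<in> ?r"
    then obtain k m where "x = g k" "y = g m" using sub by blast
    with \<open>(x, y) \<in> ?r\<close> \<open>(y, x) \<in> ?r\<close> show "x = y" by (simp add: ord_nat_sequence)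
  qed
  moreover have "total_on (range g) ?r" unfolding total_on_def by (auto simp: ord_nat_sequence)
  ultimately show ?thesis unfolding order_on_defs F using sub by blast
qed

lemma endless_nat_sequence: "endless (nat_sequence g f)"
  unfolding endless_def idx_nat_sequence
proof
  fix t assume "t \<in> range g"
  then obtain n where "t = g n" by blast
  then show "\<exists>s\<in>range g. (t, s) \<in> ord (nat_sequence g f) \<and> s \<noteq> t"
    using injD[OF g, of "Suc n" n] by (intro bexI[of _ "g (Suc n)"]) (auto simp: ord_nat_sequence)
qed

lemma increasing_tuple_nat_sequence:
  assumes "increasing_tuple (ord (nat_sequence g f)) n s"
  obtains s' where "\<And>i. i < n \<Longrightarrow> s i = g (s' i)" "\<And>i j. i < j \<Longrightarrow> j < n \<Longrightarrow> s' i < s' j"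
proof -
  have "\<forall>i<n. s i \<in> range g"
    using assms idx_nat_sequence[of f] unfolding increasing_tuple_def idx_def by blast
  then have "\<exists>m. i < n \<longrightarrow> s i = g m" for i by blast
  then obtain s' where s': "\<And>i. i < n \<Longrightarrow> s i = g (s' i)" by metis
  have "s' i < s' j" if "i < j" "j < n" for i j
  proof -
    have "(s i, s j) \<in> ord (nat_sequence g f)" "s i \<noteq> s j" using assms that unfolding increasing_tuple_def by blast+
    then show ?thesis using s'[of i] s'[of j] that by (auto simp: ord_nat_sequence order_le_less)
  qed
  then show thesis using that s' by blast
qed

end

section \<open>Indiscernible sequences in the field\<close>

lemma sat_cong: "(\<And>i. i \<in> free_vars \<phi> \<Longrightarrow> e i = e' i) \<Longrightarrow> sat e \<phi> \<longleftrightarrow> sat e' \<phi>"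
proof (induction \<phi> arbitrary: e e')
  case (Exists i \<phi>)
  have "sat (e(i := x)) \<phi> \<longleftrightarrow> sat (e'(i := x)) \<phi>" for x
    using Exists.prems by (intro Exists.IH) auto
  then show ?case by simp
next
  case (Conj \<phi> \<psi>)
  have "sat e \<phi> \<longleftrightarrow> sat e' \<phi>" by (rule Conj.IH(1)) (simp add: Conj.prems)
  moreover have "sat e \<psi> \<longleftrightarrow> sat e' \<psi>" by (rule Conj.IH(2)) (simp add: Conj.prems)
  ultimately show ?case by simp
next
  case (Neg \<phi>)
  have "sat e \<phi> \<longleftrightarrow> sat e' \<phi>" by (rule Neg.IH) (simp add: Neg.prems)
  then show ?case by simp
next
  case (Equal s t)
  have "(\<And>i. i \<in> tm_vars t \<Longrightarrow> e i = e' i) \<Longrightarrow> tm_val e t = tm_val e' t" for t by (induction t) auto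
  then show ?case using Equal by simp
next
  case (Less s t)
  have "(\<And>i. i \<in> tm_vars t \<Longrightarrow> e i = e' i) \<Longrightarrow> tm_val e t = tm_val e' t" for t by (induction t) auto
  then show ?case using Less by simp
qed

text \<open>The correspondence for two increasing tuples of the chain fixes \<open>v\<close>, so it
  also pairs the translates; sign equivalence then gives agreement on all formulas.\<close>

lemma (in poly_IVT_field) indiscernible_infinitesimal_chain:
  fixes v :: 'a
  assumes sat: "saturated \<kappa> TYPE('a)" "natLeq <o \<kappa>" and V: "infinitesimal_chain V d" and v: "v \<in> V 0" and g: "inj g"
  shows "indiscernible_sequence \<kappa> (nat_sequence g (\<lambda>n. v + d n))" (is "indiscernible_sequence \<kappa> ?S")
proof -
  have "indiscernible_over {} ?S"
    unfolding indiscernible_over_def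
  proof (intro allI impI)
    fix \<phi> n s t and e :: "nat \<Rightarrow> 'a"
    assume *: "e ` (free_vars \<phi> - {..<n}) \<subseteq> {} \<and> increasing_tuple (ord ?S) n s \<and> increasing_tuple (ord ?S) n t"
    obtain s' where s': "\<And>i. i < n \<Longrightarrow> s i = g (s' i)" "\<And>i j. i < j \<Longrightarrow> j < n \<Longrightarrow> s' i < s' j"
      using increasing_tuple_nat_sequence[OF g] * by blast
    obtain t' where t': "\<And>i. i < n \<Longrightarrow> t i = g (t' i)" "\<And>i j. i < j \<Longrightarrow> j < n \<Longrightarrow> t' i < t' j"
      using increasing_tuple_nat_sequence[OF g] * by blast
    obtain \<rho> where \<rho>: "corr \<rho>" "(v, v) \<in> \<rho>" "\<And>i. i < n \<Longrightarrow> (d (s' i), d (t' i)) \<in> \<rho>"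
      using infinitesimal_chain_corr[OF V v, of n s' t'] s'(2) t'(2) by blast
    have free: "free_vars \<phi> \<subseteq> {..<n}" using * by blast
    \<comment> \<open>With an empty parameter set all free variables are below \<open>n\<close>, so
      the remaining values may be set to 0, which is paired with itself.\<close>
    define es where "es i = (if i < n then v + d (s' i) else 0)" for i
    define et where "et i = (if i < n then v + d (t' i) else 0)" for i
    have "qf_equiv es et"
      using corrD[OF \<rho>(1)] \<rho> by (intro qf_equivI[OF \<rho>(1)]) (simp add: es_def et_def)
    then have "sat es \<phi> \<longleftrightarrow> sat et \<phi>" by (rule qf_equiv_sat[OF sat])
    moreover have "sat (\<lambda>i. if i < n then val ?S (s i) else e i) \<phi> \<longleftrightarrow> sat es \<phi>"
      using free s'(1) by (intro sat_cong) (auto simp: es_def val_nat_sequence[OF g])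
    moreover have "sat (\<lambda>i. if i < n then val ?S (t i) else e i) \<phi> \<longleftrightarrow> sat et \<phi>"
      using free t'(1) by (intro sat_cong) (auto simp: et_def val_nat_sequence[OF g])
    ultimately show "sat (\<lambda>i. if i < n then val ?S (s i) else e i) \<phi> \<longleftrightarrow> sat (\<lambda>i. if i < n then val ?S (t i) else e i) \<phi>"
      by simp
  qed
  moreover have "|range g| <o \<kappa>" by (rule countable_card_less[OF sat(2)]) simp
  ultimately show ?thesis
    unfolding indiscernible_sequence_def idx_nat_sequence[OF g] using Linear_order_nat_sequence[OF g] by blast
qed

text \<open>The formula saying that two elements are equal has the same truth value on all
  increasing pairs.\<close>

lemma indiscernible_nonconstant_inj:
  fixes S :: "('i, 'c::linordered_field) sequence"
  assumes S: "indiscernible_sequence \<kappa> S" "nonconstant S" and ij: "i \<in> idx S" "j \<in> idx S" "i \<noteq> j"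
  shows "val S i \<noteq> val S j"
proof -
  have lin: "Linear_order (ord S)" and ind: "indiscernible_over {} S"
    using S unfolding indiscernible_sequence_def by blast+
  have tot: "(a, b) \<in> ord S \<or> (b, a) \<in> ord S" if "a \<in> idx S" "b \<in> idx S" "a \<noteq> b" for a b
    using lin that unfolding linear_order_on_def total_on_def idx_def by blast
  have pair: "increasing_tuple (ord S) 2 (case_nat a (\<lambda>_. b))"
    if "(a, b) \<in> ord S" "a \<noteq> b" for a b
    using that unfolding increasing_tuple_def
    by (auto simp: Field_def less_2_cases_iff split: nat.split)
  have same: "val S a = val S b \<longleftrightarrow> val S a' = val S b'"
    if "(a, b) \<in> ord S" "a \<noteq> b" "(a', b') \<in> ord S" "a' \<noteq> b'" for a b a' b'
  proof -
    have "sat (\<lambda>i. if i < 2 then val S (case_nat a (\<lambda>_. b) i) else 0) (Equal (Var 0) (Var 1)) \<longleftrightarrow>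
      sat (\<lambda>i. if i < 2 then val S (case_nat a' (\<lambda>_. b') i) else 0) (Equal (Var 0) (Var 1))"
      by (rule ind[unfolded indiscernible_over_def, rule_format]) (use pair that in auto)
    then show ?thesis by simp
  qed
  obtain a b where ab: "a \<in> idx S" "b \<in> idx S" "val S a \<noteq> val S b" using S unfolding nonconstant_def by blast
  then have "a \<noteq> b" by auto
  then obtain a' b' where a': "(a', b') \<in> ord S" "a' \<noteq> b'" "val S a' \<noteq> val S b'"
    using tot[OF ab(1,2)] ab(3) by metis
  show ?thesis using tot[OF ij] same[OF a'(1,2)] a' ij(3) by metis
qed

text \<open>An integer polynomial vanishing at one member vanishes at all by indiscernibility. These
  are infinitely many, since the members are distinct and there is no last index.\<close>

lemma indiscernible_transcendental:
  fixes S :: "('i, 'c::linordered_field) sequence"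
  assumes S: "indiscernible_sequence \<kappa> S" "endless S" "nonconstant S" and i: "i \<in> idx S"
  shows "transcendental (val S i)"
  unfolding transcendental_def
proof (intro allI impI)
  fix t and z :: 'c assume zero: "tm_val (\<lambda>_. val S i) t = 0"
  have lin: "Linear_order (ord S)" and ind: "indiscernible_over {} S"
    using S unfolding indiscernible_sequence_def by blast+
  obtain p :: "'c poly" where p: "\<And>z. tm_val (\<lambda>_. z) t = poly p z"
    using tm_val_poly_env[of UNIV "[:0, 1:] :: 'c poly" t] by (auto simp: subring_set_def)
  \<comment> \<open>All variables are identified with variable \<open>0\<close>, so that vanishing
    becomes a formula about a single member.\<close>
  define t' where "t' = rec_tm (\<lambda>_. Var 0) Zero One (\<lambda>_ _. Add) (\<lambda>_. Minus) (\<lambda>_ _. Times) t"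
  have t': "tm_val e t' = tm_val (\<lambda>_. e 0) t" "tm_vars t' \<subseteq> {0}" for e :: "nat \<Rightarrow> 'c"
    unfolding t'_def by (induction t) auto
  have one: "increasing_tuple (ord S) 1 (\<lambda>_. j)" if "j \<in> idx S" for j
    using that unfolding increasing_tuple_def idx_def by simp
  have "poly p (val S j) = 0" if "j \<in> idx S" for j
  proof -
    have "sat (\<lambda>k. if k < 1 then val S i else 0) (Equal t' Zero) \<longleftrightarrow> sat (\<lambda>k. if k < 1 then val S j else 0) (Equal t' Zero)"
      by (rule ind[unfolded indiscernible_over_def, rule_format]) (use one[OF i] one[OF that] t'(2) in auto)
    then show ?thesis using zero by (simp add: t' p)
  qed
  then have "val S ` idx S \<subseteq> {x. poly p x = 0}" by blast
  moreover have "infinite (val S ` idx S)"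
  proof
    assume "finite (val S ` idx S)"
    moreover have "inj_on (val S) (idx S)"
      using indiscernible_nonconstant_inj[OF S(1,3)] by (auto simp: inj_on_def)
    ultimately have fin: "finite (idx S)" by (rule finite_imageD)
    \<comment> \<open>A minimal element of the reversed strict order would be a last index.\<close>
    have "wf ((ord S - Id)\<inverse>)"
    proof (rule finite_acyclic_wf)
      have "(ord S - Id)\<inverse> \<subseteq> idx S \<times> idx S" unfolding idx_def Field_def by auto
      then show "finite ((ord S - Id)\<inverse>)" using fin by (meson finite_SigmaI finite_subset)
      have "trans (ord S - Id)" "irrefl (ord S - Id)"
        using lin trans_diff_Id unfolding order_on_defs irrefl_def by blast+
      then show "acyclic ((ord S - Id)\<inverse>)" by (simp add: acyclic_irrefl)
    qed
    then obtain m where "m \<in> idx S" "\<And>y. (y, m) \<in> (ord S - Id)\<inverse> \<Longrightarrow> y \<notin> idx S"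
      using wfE_min[OF _ i] by metis
    then show False using S(2) unfolding endless_def by blast
  qed
  ultimately have "p = 0" using poly_roots_finite[of p] finite_subset by blast
  then show "tm_val (\<lambda>_. z) t = 0" by (simp add: p)
qed

section \<open>Neighbors and the failure of perpendicularity\<close>

lemma embeds_into_refl: "embeds_into S S"
  unfolding embeds_into_def by (intro exI[of _ id]) (auto simp: order_preserving_on_def)

text \<open>The connecting link is the one-element subsequence consisting of the common element.\<close>
lemma neighbors_common_element:
  fixes S T :: "('k, 'c::linordered_field) sequence"
  assumes \<kappa>: "natLeq <o \<kappa>" and S: "indiscernible_sequence \<kappa> S" and T: "indiscernible_sequence \<kappa> T"
    and i: "i \<in> idx S" and j: "j \<in> idx T" and eq: "val S i = val T j"
  shows "neighbors \<kappa> S T"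
proof -
  define U :: "('k, 'c) sequence" where "U = \<lparr>ord = {(i, i)}, val = \<lambda>_. val S i\<rparr>"
  have U: "ord U = {(i, i)}" "idx U = {i}" "val U = (\<lambda>_. val S i)" by (simp_all add: U_def idx_def Field_def)
  have "indiscernible_sequence \<kappa> U"
    unfolding indiscernible_sequence_def
  proof (intro conjI)
    show "Linear_order (ord U)" by (simp add: U order_on_defs refl_on_def trans_def antisym_def total_on_def Field_def)
    show "|idx U| <o \<kappa>" by (rule countable_card_less[OF \<kappa>]) (simp add: U)
    show "indiscernible_over {} U" unfolding indiscernible_over_def U by simp
  qed (simp add: U)
  have emb: "embeds_into U W" if "k \<in> idx W" "Linear_order (ord W)" "val W k = val S i" for W :: "('k, 'c) sequence" and k
  proof -
    have "(k, k) \<in> ord W" using that unfolding idx_def order_on_defs refl_on_def by blast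
    then show ?thesis
      unfolding embeds_into_def U order_preserving_on_def using that by (intro exI[of _ "\<lambda>_. k"]) simp
  qed
  have "embeds_into U S" "embeds_into U T"
    using emb[OF i] emb[OF j] eq S T unfolding indiscernible_sequence_def by simp_all
  then have im: "immediate_neighbors \<kappa> S U" "immediate_neighbors \<kappa> U T"
    unfolding immediate_neighbors_def using S T embeds_into_refl by blast+
  define B where "B m = (if m = 0 then S else if m = 1 then U else T)" for m :: nat
  have "\<forall>k\<le>2. indiscernible_sequence \<kappa> (B k)"
    using S T \<open>indiscernible_sequence \<kappa> U\<close> by (simp add: B_def)
  moreover have "\<forall>k<2. immediate_neighbors \<kappa> (B k) (B (Suc k))"
    using im by (auto simp: B_def less_2_cases_iff)
  moreover have "B 0 = S" "B 2 = T" by (simp_all add: B_def)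
  ultimately show ?thesis unfolding neighbors_def by blast
qed

lemma indiscernible_singleton_parameter:
  assumes "indiscernible_over B \<lparr>ord = natLeq, val = b\<rparr>" "e ` (free_vars \<phi> - {0}) \<subseteq> B"
  shows "sat (e(0 := b m)) \<phi> \<longleftrightarrow> sat (e(0 := b n)) \<phi>"
proof -
  let ?S = "\<lparr>ord = natLeq, val = b\<rparr>"
  have one: "increasing_tuple (ord ?S) 1 (\<lambda>_. k)" for k
    unfolding increasing_tuple_def by (simp add: Field_natLeq)
  have upd: "(\<lambda>i. if i < (1::nat) then val ?S k else e i) = e(0 := b k)" for k by auto
  have "e ` (free_vars \<phi> - {..<1}) \<subseteq> B" using assms(2) by auto
  then show ?thesis
    using assms(1)[unfolded indiscernible_over_def, rule_format, of e \<phi> 1 "\<lambda>_. m" "\<lambda>_. n"] one upd by simp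
qed

text \<open>
  Translating by \<open>v\<^sub>1\<close> and \<open>v\<^sub>2\<close> makes both sequences define the same cut. A realization chosen after
  another one is larger, so that the two sequences of realizations interleave.
\<close>
lemma not_perpendicular_translates:
  fixes v\<^sub>1 v\<^sub>2 :: "'c::linordered_field"
  assumes \<kappa>: "natLeq <o \<kappa>" and g: "inj g" and dec: "\<And>m n. m < n \<Longrightarrow> d n < d m"
  shows "\<not> perpendicular \<kappa> (nat_sequence g (\<lambda>n. v\<^sub>1 + d n)) (nat_sequence g (\<lambda>n. v\<^sub>2 + d n))"
    (is "\<not> perpendicular \<kappa> ?S1 ?S2")
proof
  assume "perpendicular \<kappa> ?S1 ?S2"
  moreover have "|{v\<^sub>1, v\<^sub>2}| <o \<kappa>" by (rule countable_card_less[OF \<kappa>]) simp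
  ultimately obtain b1 b2 where
    b1: "\<And>n. realizes (b1 n) (Av ({v\<^sub>1, v\<^sub>2} \<union> elems ?S1 \<union> elems ?S2 \<union> b1 ` {..<n} \<union> b2 ` {..<n}) ?S1)" and
    b2: "\<And>n. realizes (b2 n) (Av ({v\<^sub>1, v\<^sub>2} \<union> elems ?S1 \<union> elems ?S2 \<union> b1 ` {..n} \<union> b2 ` {..<n}) ?S2)" and
    mut: "mutually_indiscernible_over ({v\<^sub>1, v\<^sub>2} \<union> elems ?S1 \<union> elems ?S2) \<lparr>ord = natLeq, val = b1\<rparr> \<lparr>ord = natLeq, val = b2\<rparr>"
    unfolding perpendicular_def by blast
  \<comment> \<open>Comparison of two elements after translation, with both translations moved to
    the other side of the inequality so that only sums occur.\<close>
  define \<phi> where "\<phi> = Less (Add (Var 1) (Var 2)) (Add (Var 0) (Var 3))"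
  define E where "E v b w = (\<lambda>i::nat. if i = 1 then b else if i = 2 then v else w)" for v b w :: 'c
  have \<phi>: "sat ((E v b w)(0 := x)) \<phi> \<longleftrightarrow> b + v < x + w" for v b w x by (simp add: \<phi>_def E_def)
  have free: "E v b w ` (free_vars \<phi> - {0}) \<subseteq> B" if "v \<in> B" "b \<in> B" "w \<in> B" for v b w B
    using that by (auto simp: \<phi>_def E_def)
  have av: "b + v < x + w"
    if real: "realizes x (Av B (nat_sequence g (\<lambda>n. u + d n)))" and B: "v \<in> B" "b \<in> B" "w \<in> B"
      and ev: "\<And>n. n \<ge> m \<Longrightarrow> b + v < u + d n + w" for x u v b w B m
  proof -
    let ?S = "nat_sequence g (\<lambda>n. u + d n)"
    have "sat ((E v b w)(0 := val ?S t)) \<phi>" if t: "t \<in> idx ?S" "(g m, t) \<in> ord ?S" for t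
    proof -
      obtain n where "t = g n" using t(1) unfolding idx_nat_sequence[OF g] by blast
      then show ?thesis using ev[of n] t(2) by (simp add: \<phi> val_nat_sequence[OF g] ord_nat_sequence[OF g])
    qed
    moreover have "g m \<in> idx ?S" unfolding idx_nat_sequence[OF g] by simp
    ultimately have "(\<phi>, E v b w) \<in> Av B ?S"
      unfolding Av_def formulas_over_def using free[OF B] by auto
    then have "sat ((E v b w)(0 := x)) \<phi>" using real unfolding realizes_def by blast
    then show ?thesis unfolding \<phi> .
  qed
  note elems = elems_nat_sequence[OF g]
  have below: "x < u + d n" if real: "realizes x (Av B (nat_sequence g (\<lambda>n. u + d n)))" and B: "u + d n \<in> B" for x u B n
  proof -
    let ?S = "nat_sequence g (\<lambda>n. u + d n)"
    let ?\<psi> = "Less (Var 0) (Var 1)" and ?e = "\<lambda>_ :: nat. u + d n"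
    have "sat (?e(0 := val ?S t)) ?\<psi>" if t: "t \<in> idx ?S" "(g (Suc n), t) \<in> ord ?S" for t
    proof -
      obtain m where "t = g m" using t(1) unfolding idx_nat_sequence[OF g] by blast
      then show ?thesis using t(2) dec[of n m] by (simp add: val_nat_sequence[OF g] ord_nat_sequence[OF g])
    qed
    moreover have "g (Suc n) \<in> idx ?S" unfolding idx_nat_sequence[OF g] by simp
    ultimately have "(?\<psi>, ?e) \<in> Av B ?S"
      unfolding Av_def formulas_over_def using B by auto
    then have "sat (?e(0 := x)) ?\<psi>" using real unfolding realizes_def by blast
    then show ?thesis by simp
  qed
  have below: "b1 0 < v\<^sub>1 + d n" "b2 0 < v\<^sub>2 + d n" for n
    by (rule below[OF b1]; simp add: elems) (rule below[OF b2]; simp add: elems)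
  \<comment> \<open>As \<open>b1 0\<close> lies below every \<open>v\<^sub>1 + d n\<close>, its
    translate lies below the whole second sequence, and the average type of that sequence places
    \<open>b2 0\<close> above it. The next step repeats this with the roles exchanged.\<close>
  have step1: "b1 0 + v\<^sub>2 < b2 0 + v\<^sub>1"
    by (rule av[OF b2, where m = 0]) (use below(1) in \<open>simp_all add: algebra_simps\<close>)
  have step2: "b2 0 + v\<^sub>1 < b1 1 + v\<^sub>2"
    by (rule av[OF b1, where m = 0]) (use below(2) in \<open>simp_all add: algebra_simps\<close>)
  let ?B = "{v\<^sub>1, v\<^sub>2} \<union> elems ?S1 \<union> elems ?S2 \<union> elems \<lparr>ord = natLeq, val = b2\<rparr>"
  have "b2 0 \<in> ?B" by (simp add: elems_def idx_def Field_natLeq)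
  then have "E v\<^sub>1 (b2 0) v\<^sub>2 ` (free_vars \<phi> - {0}) \<subseteq> ?B" by (intro free) simp_all
  moreover have "indiscernible_over ?B \<lparr>ord = natLeq, val = b1\<rparr>"
    using mut unfolding mutually_indiscernible_over_def by blast
  \<comment> \<open>Over the parameter \<open>b2 0\<close> the members \<open>b1 0\<close> and
    \<open>b1 1\<close> must satisfy the same formulas, but the translate of \<open>b2 0\<close>
    separates them.\<close>
  ultimately have "sat ((E v\<^sub>1 (b2 0) v\<^sub>2)(0 := b1 0)) \<phi> \<longleftrightarrow> sat ((E v\<^sub>1 (b2 0) v\<^sub>2)(0 := b1 1)) \<phi>"
    by (intro indiscernible_singleton_parameter)
  then show False using step1 step2 unfolding \<phi> by simp
qed

text \<open>The chain is given in advance and does not depend on \<open>S\<close>, so that two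
  sequences can be treated with the same \<open>d\<close>.\<close>

lemma (in poly_IVT_field) translate_neighbor_exists:
  fixes S :: "('k, 'a) sequence"
  assumes sat: "saturated \<kappa> TYPE('a)" "natLeq <o \<kappa>" and R: "infinitesimal_chain R d" and g: "inj g"
    and S: "indiscernible_sequence \<kappa> S" "endless S" "nonconstant S" and i: "i \<in> idx S" "val S i \<in> R 0"
  shows "\<exists>v. indiscernible_sequence \<kappa> (nat_sequence g (\<lambda>n. v + d n)) \<and> neighbors \<kappa> (nat_sequence g (\<lambda>n. v + d n)) S"
proof -
  define v where "v = val S i - d 0"
  let ?T = "nat_sequence g (\<lambda>n. v + d n)"
  have "transcendental (val S i)" by (rule indiscernible_transcendental[OF S i(1)])
  note chain = infinitesimal_chain_shift[OF R i(2) this, folded v_def]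
  have "v \<in> range (tm_val (\<lambda>_. v))" using rangeI[of "tm_val (\<lambda>_. v)" "Var 0"] by simp
  then have T: "indiscernible_sequence \<kappa> ?T"
    by (intro indiscernible_infinitesimal_chain[OF sat chain _ g]) simp
  moreover have "neighbors \<kappa> ?T S"
    by (rule neighbors_common_element[OF sat(2) T S(1) _ i(1), of "g 0"])
      (simp_all add: idx_nat_sequence[OF g] val_nat_sequence[OF g] v_def)
  ultimately show ?thesis by blast
qed

theorem theorem63:
  fixes \<kappa> :: "'k rel"
    and a1 a2 :: "('k, 'c::linordered_field) sequence"
  assumes "real_closed TYPE('f::linordered_field)"
    and "monster_model \<kappa> TYPE('c) (Th TYPE('f))"
    and "indiscernible_sequence \<kappa> a1" and "endless a1" and "nonconstant a1"
    and "indiscernible_sequence \<kappa> a2" and "endless a2" and "nonconstant a2"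
  shows "\<not> strongly_perpendicular \<kappa> a1 a2"
proof
  assume sp: "strongly_perpendicular \<kappa> a1 a2"
  have \<kappa>: "Card_order \<kappa>" "natLeq <o \<kappa>" and sat: "saturated \<kappa> TYPE('c)" and "models TYPE('c) (Th TYPE('f))"
    using assms(2) unfolding monster_model_def by blast+
  then have "real_closed TYPE('c)" using real_closed_transfer assms(1) by blast
  then interpret poly_IVT_field "TYPE('c)" by unfold_locales (rule real_closed_poly_IVT)
  \<comment> \<open>The index type must be infinite to carry sequences of order type omega.\<close>
  have "natLeq \<le>o |Field \<kappa>|"
    using \<kappa> card_of_Field_ordIso ordIso_symmetric ordLeq_ordIso_trans ordLess_imp_ordLeq by blast
  then have "infinite (UNIV :: 'k set)" by (meson infinite_iff_natLeq_ordLeq finite_subset top_greatest)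
  then obtain g :: "nat \<Rightarrow> 'k" where g: "inj g" using infinite_countable_subset by blast
  obtain i j where i: "i \<in> idx a1" and j: "j \<in> idx a2"
    using assms(3,6) unfolding indiscernible_sequence_def by blast
  \<comment> \<open>A single chain over one member of each sequence makes the two replacements
    translates of each other.\<close>
  obtain R d where R: "{val a1 i, val a2 j} \<subseteq> R 0" "infinitesimal_chain R d"
    using infinitesimal_chain_exists[OF sat \<kappa>(2), of "{val a1 i, val a2 j}"] by auto
  obtain v\<^sub>1 where v1: "indiscernible_sequence \<kappa> (nat_sequence g (\<lambda>n. v\<^sub>1 + d n))"
    "neighbors \<kappa> (nat_sequence g (\<lambda>n. v\<^sub>1 + d n)) a1"
    using translate_neighbor_exists[OF sat \<kappa>(2) R(2) g assms(3-5) i] R(1) by blast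
  obtain v\<^sub>2 where v2: "indiscernible_sequence \<kappa> (nat_sequence g (\<lambda>n. v\<^sub>2 + d n))"
    "neighbors \<kappa> (nat_sequence g (\<lambda>n. v\<^sub>2 + d n)) a2"
    using translate_neighbor_exists[OF sat \<kappa>(2) R(2) g assms(6-8) j] R(1) by blast
  have "perpendicular \<kappa> (nat_sequence g (\<lambda>n. v\<^sub>1 + d n)) (nat_sequence g (\<lambda>n. v\<^sub>2 + d n))"
    using sp v1 v2 endless_nat_sequence[OF g] unfolding strongly_perpendicular_def by blast
  then show False
    using not_perpendicular_translates[OF \<kappa>(2) g, of d] infinitesimal_chain_decreasing[OF R(2)] by blast
qed

end
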